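(* Let $\mathcal{A}$ be a $p$-adic Banach algebra over $\Omega_p$, and let $A\in\mathcal{A}$ be $\mathcal{A}$-analytic with spectrum $\sigma_A$. Let $f\in\mathcal{F}(A)$. Let $0<r\in|\Omega_p|_p$ and let $\Gamma\in\Omega_p$ with $|\Gamma|_p=r$. Assume that $a_1,\ldots,a_N\in\Omega_p$ are given with $$\sigma_A\subseteq\bigcup_{i=1}^N D_{a_i}(r^-),$$ where the discs $D_{a_i}(r)$ are pairwise disjoint and $f$ is Krasner analytic on each $D_{a_i}(r)$. Define $$f(A)=\sum_{i=1}^N\int_{a_i,\Gamma} f(x)(x-a_i)R(x;A)\,dx .$$ Let $g\in\mathcal{F}(A)$ and let $\alpha,\beta\in\Omega_p$. Then $\alpha f+\beta g\in\mathcal{F}(A)$ and $f\cdot g\in\mathcal{F}(A)$, and: (i) $(\alpha f+\beta g)(A)=\alpha f(A)+\beta g(A)$; (ii) $(f\cdot g)(A)=f(A)\,g(A)$; (iii) the mapping $h\mapsto h(A)$ is continuous on $B_r(\sigma_A)$ (with respect to the norm $\|\cdot\|_r$).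
   Context: Let $p$ be a prime and let $\Omega_p$ be the completion of an algebraic closure of $\mathbb{Q}_p$, with norm $|\cdot|_p$; $|\Omega_p|_p$ is the set of values of $|\cdot|_p$. For $a\in\Omega_p$, $\sigma\subseteq\Omega_p$, $r>0$: $D_a(r)=\{x\in\Omega_p: |x-a|_p\le r\}$, $D_a(r^-)=\{x\in\Omega_p:|x-a|_p<r\}$, $D_\sigma(r)=\{x\in\Omega_p:\mathrm{dist}(x,\sigma)\le r\}$, $D_\sigma(r^-)=\{x\in\Omega_p:\mathrm{dist}(x,\sigma)<r\}$. An $\Omega_p$-valued function $f$ is Krasner analytic on $D_a(r)$ if on $D_a(r)$ it is given by a power series $f(x)=\sum_{k\ge0}c_k(x-a)^k$ with $\lim_{k\to\infty} r^k|c_k|_p=0$. For $\emptyset\ne\sigma\subseteq\Omega_p$ and $r>0$, $B_r(\sigma)$ is the set of functions $f:D_\sigma(r)\to\Omega_p$ that are Krasner analytic on $D_a(r)$ whenever $D_a(r)\subseteq D_\sigma(r)$; if $f$ is bounded on $D_\sigma(r)$, $\|f\|_r=\max_{x\in D_\sigma(r)}|f(x)|_p$. $L(\sigma)$ (locally analytic functions on $\sigma$) is the set of $\Omega_p$-valued functions $f$ for which there exist $a_1,\dots,a_N\in\Omega_p$ and $0<r\in|\Omega_p|_p$ with $\sigma\subseteq\bigcup_i D_{a_i}(r^-)$, the $D_{a_i}(r)$ pairwise disjoint, and $f$ Krasner analytic on each $D_{a_i}(r)$. Sums and products of such functions are taken pointwise where both are defined. For compact $\sigma\subseteq\Omega_p$,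 write $\overline{\sigma}=\Omega_p\setminus\sigma$ (complement). $H_0(\overline\sigma)$ is the set of $\varphi:\overline\sigma\to\Omega_p$ that are limits of rational functions with poles in $\sigma$, the limit being uniform on every set $\{z:\mathrm{dist}(z,\sigma)\ge r\}$, $r>0$, and such that $\lim_{|z|_p\to\infty}\varphi(z)=0$. A $p$-adic Banach space over $\Omega_p$ is a complete normed $\Omega_p$-vector space $\mathcal{X}$ with ultrametric norm $\|\cdot\|_p$ satisfying $\|ax\|_p=|a|_p\|x\|_p$, and with $\|\mathcal{X}\|_p=|\Omega_p|_p$; $\mathcal{X}^*$ is its dual and $B(\mathcal{X})$ the algebra of continuous linear operators with operator norm. A $p$-adic Banach algebra is a $p$-adic Banach space that is a unital $\Omega_p$-algebra with $\|xy\|_p\le\|x\|_p\|y\|_p$. The spectrum $\sigma_x$ of an element $x$ is the set of $z\in\Omega_p$ with $z-x$ not invertible; the resolvent is $R(z;x)=(z-x)^{-1}$, $z\notin\sigma_x$. For a nonempty set $J$, $\Omega_p(J)$ is the $p$-adic Banach space of families $(c_j)_{j\in J}$ in $\Omega_p$ such that for every $\epsilon>0$ only finitely many $|c_j|_p$ exceed $\epsilon$, with norm $\max_j|c_j|_p$; $\simeq$ means isomorphic as $p$-adic Banach spaces. An operator $T\in B(\mathcal{X})$ with compact spectrum is analytic if for all $x\in\mathcal{X}$, $h\in\mathcal{X}^*$ the function $z\mapsto h(R(z;T)x)$ is in $H_0(\overline{\sigma}_T)$. An element $A$ of a $p$-adic Banach algebra $\mathcal{A}$ with compact spectrum is $\mathcal{X}$-analytic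 if there is a continuous injective $\Omega_p$-algebra homomorphism $\theta:\mathcal{A}\to B(\mathcal{X})$ with $\theta^{-1}:\theta(\mathcal{A})\to\mathcal{A}$ continuous and $\theta(A)$ analytic. An element $A\in\mathcal{A}$ is $\mathcal{A}$-analytic if there are a sequence $(A_k)$ in $\mathcal{A}$ and $p$-adic Banach spaces $\mathcal{X}_k\simeq\Omega_p(J_k)$, $J_k\neq\emptyset$, such that $\sigma_{A_k}$ is nonempty and compact, $A_k$ is $\mathcal{X}_k$-analytic, and $\lim_k\|A-A_k\|_p=0$. (An $\mathcal{A}$-analytic element has nonempty spectrum.) $\mathcal{F}(A)=L(\sigma_A)$. The Shnirelman integral of a (scalar- or algebra-valued) function $F$, for $|\Gamma|_p=r$, is $\int_{a,\Gamma}F(x)\,dx=\lim_{n\to\infty,\;p\nmid n}\frac1n\sum_{\xi^n=1}F(a+\xi\Gamma)$ (sum over the $n$-th roots of unity in $\Omega_p$); a finite sum of such integrals over the circles about $a_1,\dots,a_N$ is understood as the limit over $n$, $p\nmid n$, of the sum of the corresponding averages. For $A$ $\mathcal{A}$-analytic and $f\in\mathcal{F}(A)$, $f(A)$ is defined by $f(A)=\sum_{i=1}^N\int_{a_i,\Gamma}f(x)(x-a_i)R(x;A)\,dx$ for any choice of $a_1,\dots,a_N\in\Omega_p$, $0<r\in|\Omega_p|_p$, $|\Gamma|_p=r$, with $\sigma_A\subseteq\bigcup_i D_{a_i}(r^-)$, the $D_{a_i}(r)$ pairwise disjoint and $f$ Krasner analytic on each $D_{a_i}(r)$; the limit exists and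 is independent of these choices. *)

theory Defs
  imports "HOL-Analysis.Analysis" "HOL-Library.Function_Algebras"
    "HOL-Computational_Algebra.Polynomial"
begin

section \<open>The field of scalars\<close>

text \<open>The library restricts the constant \<open>norm\<close> to real vector spaces, so norms over non-Archimedean
  fields need their own constant.  Being metric spaces, the structures below inherit limits, \<open>ball\<close>,
  \<open>cball\<close>, \<open>closure\<close>, \<open>compact\<close>, \<open>uniform_limit\<close>, \<open>infdist\<close> from the library.\<close>

class pnormed = ab_group_add + metric_space +
  fixes pnorm :: "'a \<Rightarrow> real"
  assumes dist_pnorm: "dist x y = pnorm (x - y)"

class ultranormed_field = field_char_0 + pnormed +
  assumes pnorm_ultra: "pnorm (x + y) \<le> max (pnorm x) (pnorm y)"
    and pnorm_mult: "pnorm (x * y) = pnorm x * pnorm y"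

text \<open>In a complete field whose norm is \<open>p\<close>-adic on the rationals, the closure of the rationals is
  their completion.\<close>

definition Qp :: "'k::ultranormed_field set" where
  "Qp = closure \<rat>"

definition Qp_alg :: "'k::ultranormed_field set" where
  "Qp_alg = {x. \<exists>q::'k poly. q \<noteq> 0 \<and> (\<forall>i. coeff q i \<in> Qp) \<and> poly q x = 0}"

text \<open>\<open>Omega_p p TYPE('k)\<close>: the field \<open>'k\<close> is a completion of an algebraic closure of \<open>Qp\<close>.
  If \<open>'k\<close> contains an algebraic closure of \<open>Qp\<close>, then this closure is \<open>Qp_alg\<close>, the set of all
  elements that are algebraic over \<open>Qp\<close>.\<close>

locale Omega_p =
  fixes p :: nat and K :: "'k::{ultranormed_field, complete_space} itself"
  assumes prime_p: "prime p"
    and pnorm_of_int: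
      "\<And>m::int. m \<noteq> 0 \<Longrightarrow> pnorm (of_int m :: 'k) = (1 / real p) ^ multiplicity (int p) m"
    and Qp_alg_closed:
      "\<And>q::'k poly. degree q > 0 \<Longrightarrow> (\<forall>i. coeff q i \<in> Qp_alg) \<Longrightarrow> \<exists>x\<in>Qp_alg. poly q x = 0"
    and Qp_alg_dense: "closure (Qp_alg :: 'k set) = UNIV"

section \<open>Analytic functions\<close>

text \<open>The discs \<open>D\<^sub>a(r)\<close> and \<open>D\<^sub>a(r\<^sup>-)\<close> are \<open>cball a r\<close> and \<open>ball a r\<close>.  Partially defined functions are
  represented by total ones; every notion below only looks at values on the relevant domain.\<close>

definition krasner_analytic :: "('k::ultranormed_field \<Rightarrow> 'k) \<Rightarrow> 'k \<Rightarrow> real \<Rightarrow> bool" where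
  "krasner_analytic f a r \<longleftrightarrow>
     (\<exists>c. (\<lambda>k. r ^ k * pnorm (c k)) \<longlonglongrightarrow> 0 \<and>
          (\<forall>x\<in>cball a r. (\<lambda>k. c k * (x - a) ^ k) sums f x))"

text \<open>\<open>D\<^sub>\<sigma>(r)\<close>; used for nonempty \<open>\<sigma>\<close> only.\<close>

definition nbhd :: "'k::ultranormed_field set \<Rightarrow> real \<Rightarrow> 'k set" where
  "nbhd \<sigma> r = {x. infdist x \<sigma> \<le> r}"

definition B_space :: "real \<Rightarrow> 'k::ultranormed_field set \<Rightarrow> ('k \<Rightarrow> 'k) set" where
  "B_space r \<sigma> = {f. \<forall>a. cball a r \<subseteq> nbhd \<sigma> r \<longrightarrow> krasner_analytic f a r}"

definition B_norm :: "real \<Rightarrow> 'k::ultranormed_field set \<Rightarrow> ('k \<Rightarrow> 'k) \<Rightarrow> real" where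
  "B_norm r \<sigma> f = (SUP x\<in>nbhd \<sigma> r. pnorm (f x))"

definition admissible ::
  "'k::ultranormed_field set \<Rightarrow> ('k \<Rightarrow> 'k) \<Rightarrow> nat \<Rightarrow> (nat \<Rightarrow> 'k) \<Rightarrow> real \<Rightarrow> bool" where
  "admissible \<sigma> f N a r \<longleftrightarrow>
     0 < r \<and> r \<in> range (pnorm :: 'k \<Rightarrow> real) \<and>
     \<sigma> \<subseteq> (\<Union>i\<in>{1..N}. ball (a i) r) \<and>
     disjoint_family_on (\<lambda>i. cball (a i) r) {1..N} \<and>
     (\<forall>i\<in>{1..N}. krasner_analytic f (a i) r)"

definition L_space :: "'k::ultranormed_field set \<Rightarrow> ('k \<Rightarrow> 'k) set" where
  "L_space \<sigma> = {f. \<exists>N a r. admissible \<sigma> f N a r}"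

definition rational_poles_in :: "'k::ultranormed_field set \<Rightarrow> ('k \<Rightarrow> 'k) set" where
  "rational_poles_in \<sigma> =
     {\<lambda>z. poly P z / poly Q z | P Q. Q \<noteq> 0 \<and> (\<forall>z. poly Q z = 0 \<longrightarrow> z \<in> \<sigma>)}"

text \<open>\<open>H_zero \<sigma>\<close> is the space of functions on the complement of \<open>\<sigma>\<close>.  The condition \<open>dist(z,\<sigma>) \<ge> r\<close>
  is written out pointwise because \<open>infdist z {} = 0\<close>, whereas here the distance to the empty set
  has to be infinite.\<close>

definition H_zero :: "'k::ultranormed_field set \<Rightarrow> ('k \<Rightarrow> 'k) set" where
  "H_zero \<sigma> =
     {\<phi>. (\<exists>\<rho>. (\<forall>n. \<rho> n \<in> rational_poles_in \<sigma>) \<and>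
              (\<forall>r>0. uniform_limit {z. \<forall>y\<in>\<sigma>. r \<le> dist z y} \<rho> \<phi> sequentially)) \<and>
         (\<phi> \<longlongrightarrow> 0) (filtercomap pnorm at_top)}"

section \<open>Banach spaces and their operators\<close>

text \<open>The definition of an analytic element of an algebra quantifies existentially over a sequence of
  Banach spaces.  A Banach space is therefore given by a scalar multiplication \<open>s\<close>, a carrier \<open>V\<close>
  inside some additive group, and a norm \<open>nV\<close> on \<open>V\<close>.  Any sequence of vector spaces embeds
  into a common one (their direct sum), so this is no restriction.\<close>

abbreviation (input) norm_dist :: "('x::ab_group_add \<Rightarrow> real) \<Rightarrow> 'x \<Rightarrow> 'x \<Rightarrow> real" where
  "norm_dist nV \<equiv> (\<lambda>x y. nV (x - y))"

abbreviation (input) norm_topology :: "'x::ab_group_add set \<Rightarrow> ('x \<Rightarrow> real) \<Rightarrow> 'x topology" where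
  "norm_topology V nV \<equiv> Metric_space.mtopology V (norm_dist nV)"

definition padic_banach_space ::
  "('k::ultranormed_field \<Rightarrow> 'x::ab_group_add \<Rightarrow> 'x) \<Rightarrow> 'x set \<Rightarrow> ('x \<Rightarrow> real) \<Rightarrow> bool" where
  "padic_banach_space s V nV \<longleftrightarrow>
     vector_space s \<and> module.subspace s V \<and>
     (\<forall>x\<in>V. 0 \<le> nV x \<and> (nV x = 0 \<longleftrightarrow> x = 0)) \<and>
     (\<forall>x\<in>V. \<forall>y\<in>V. nV (x + y) \<le> max (nV x) (nV y)) \<and>
     (\<forall>c. \<forall>x\<in>V. nV (s c x) = pnorm c * nV x) \<and>
     nV ` V = range (pnorm :: 'k \<Rightarrow> real) \<and>
     Metric_space.mcomplete V (norm_dist nV)"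

definition linear_between ::
  "('k \<Rightarrow> 'x::ab_group_add \<Rightarrow> 'x) \<Rightarrow> 'x set \<Rightarrow> ('k \<Rightarrow> 'y::ab_group_add \<Rightarrow> 'y) \<Rightarrow> ('x \<Rightarrow> 'y) \<Rightarrow> bool"
  where
  "linear_between s V s' T \<longleftrightarrow>
     (\<forall>x\<in>V. \<forall>y\<in>V. T (x + y) = T x + T y) \<and> (\<forall>c. \<forall>x\<in>V. T (s c x) = s' c (T x))"

definition banach_isomorphic ::
  "('k::ultranormed_field \<Rightarrow> 'x::ab_group_add \<Rightarrow> 'x) \<Rightarrow> 'x set \<Rightarrow> ('x \<Rightarrow> real) \<Rightarrow>
   ('k \<Rightarrow> 'y::ab_group_add \<Rightarrow> 'y) \<Rightarrow> 'y set \<Rightarrow> ('y \<Rightarrow> real) \<Rightarrow> bool" where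
  "banach_isomorphic s V nV s' W nW \<longleftrightarrow>
     (\<exists>\<phi>. linear_between s V s' \<phi> \<and>
          homeomorphic_map (norm_topology V nV) (norm_topology W nW) \<phi>)"

definition fun_scale :: "'k::ultranormed_field \<Rightarrow> ('j \<Rightarrow> 'k) \<Rightarrow> 'j \<Rightarrow> 'k" where
  "fun_scale b c = (\<lambda>j. b * c j)"

text \<open>\<open>null_families J\<close> with \<open>fun_scale\<close> and \<open>null_norm J\<close> is \<open>\<Omega>\<^sub>p(J)\<close>; a family indexed by \<open>J\<close> is
  extended by zero.\<close>

definition null_families :: "'j set \<Rightarrow> ('j \<Rightarrow> 'k::ultranormed_field) set" where
  "null_families J = {c. (\<forall>j. j \<notin> J \<longrightarrow> c j = 0) \<and> (\<forall>\<epsilon>>0. finite {j\<in>J. pnorm (c j) > \<epsilon>})}"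

definition null_norm :: "'j set \<Rightarrow> ('j \<Rightarrow> 'k::ultranormed_field) \<Rightarrow> real" where
  "null_norm J c = (SUP j\<in>J. pnorm (c j))"

definition dual_space ::
  "('k::ultranormed_field \<Rightarrow> 'x::ab_group_add \<Rightarrow> 'x) \<Rightarrow> 'x set \<Rightarrow> ('x \<Rightarrow> real) \<Rightarrow> ('x \<Rightarrow> 'k) set" where
  "dual_space s V nV =
     {h. linear_between s V (*) h \<and> continuous_map (norm_topology V nV) euclidean h}"

text \<open>Operators on \<open>V\<close> are extensional functions, so that equality of operators is equality on \<open>V\<close>.\<close>

definition operators ::
  "('k \<Rightarrow> 'x::ab_group_add \<Rightarrow> 'x) \<Rightarrow> 'x set \<Rightarrow> ('x \<Rightarrow> real) \<Rightarrow> ('x \<Rightarrow> 'x) set" where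
  "operators s V nV =
     {T \<in> V \<rightarrow>\<^sub>E V. linear_between s V s T \<and>
                  continuous_map (norm_topology V nV) (norm_topology V nV) T}"

definition op_norm :: "'x::ab_group_add set \<Rightarrow> ('x \<Rightarrow> real) \<Rightarrow> ('x \<Rightarrow> 'x) \<Rightarrow> real" where
  "op_norm V nV T = (SUP x\<in>V - {0}. nV (T x) / nV x)"

definition op_topology ::
  "('k \<Rightarrow> 'x::ab_group_add \<Rightarrow> 'x) \<Rightarrow> 'x set \<Rightarrow> ('x \<Rightarrow> real) \<Rightarrow> ('x \<Rightarrow> 'x) topology" where
  "op_topology s V nV =
     Metric_space.mtopology (operators s V nV) (\<lambda>S T. op_norm V nV (\<lambda>x\<in>V. S x - T x))"

definition is_op_resolvent ::
  "('k \<Rightarrow> 'x::ab_group_add \<Rightarrow> 'x) \<Rightarrow> 'x set \<Rightarrow> ('x \<Rightarrow> real) \<Rightarrow> ('x \<Rightarrow> 'x) \<Rightarrow> 'k \<Rightarrow> ('x \<Rightarrow> 'x) \<Rightarrow> bool"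
  where
  "is_op_resolvent s V nV T z S \<longleftrightarrow>
     S \<in> operators s V nV \<and>
     compose V S (\<lambda>x\<in>V. s z x - T x) = (\<lambda>x\<in>V. x) \<and>
     compose V (\<lambda>x\<in>V. s z x - T x) S = (\<lambda>x\<in>V. x)"

definition op_spectrum ::
  "('k \<Rightarrow> 'x::ab_group_add \<Rightarrow> 'x) \<Rightarrow> 'x set \<Rightarrow> ('x \<Rightarrow> real) \<Rightarrow> ('x \<Rightarrow> 'x) \<Rightarrow> 'k set" where
  "op_spectrum s V nV T = {z. \<not> (\<exists>S. is_op_resolvent s V nV T z S)}"

definition op_resolvent ::
  "('k \<Rightarrow> 'x::ab_group_add \<Rightarrow> 'x) \<Rightarrow> 'x set \<Rightarrow> ('x \<Rightarrow> real) \<Rightarrow> 'k \<Rightarrow> ('x \<Rightarrow> 'x) \<Rightarrow> 'x \<Rightarrow> 'x" where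
  "op_resolvent s V nV z T = (THE S. is_op_resolvent s V nV T z S)"

definition analytic_operator ::
  "('k::ultranormed_field \<Rightarrow> 'x::ab_group_add \<Rightarrow> 'x) \<Rightarrow> 'x set \<Rightarrow> ('x \<Rightarrow> real) \<Rightarrow> ('x \<Rightarrow> 'x) \<Rightarrow> bool"
  where
  "analytic_operator s V nV T \<longleftrightarrow>
     T \<in> operators s V nV \<and> compact (op_spectrum s V nV T) \<and>
     (\<forall>x\<in>V. \<forall>h\<in>dual_space s V nV.
        (\<lambda>z. h (op_resolvent s V nV z T x)) \<in> H_zero (op_spectrum s V nV T))"

section \<open>Banach algebras and analytic elements\<close>

locale padic_banach_algebra = Omega_p p "TYPE('k)"
  for p :: nat and smul :: "'k::{ultranormed_field, complete_space} \<Rightarrow>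
      'a::{ring_1, pnormed} \<Rightarrow> 'a" +
  assumes banach_space: "padic_banach_space smul UNIV pnorm"
    and scale_mult_left: "\<And>c x y. smul c (x * y) = smul c x * y"
    and scale_mult_right: "\<And>c x y. smul c (x * y) = x * smul c y"
    and pnorm_mult_le: "\<And>x y :: 'a. pnorm (x * y) \<le> pnorm x * pnorm y"

definition invertible_element :: "'a::ring_1 \<Rightarrow> bool" where
  "invertible_element x \<longleftrightarrow> (\<exists>y. x * y = 1 \<and> y * x = 1)"

definition spectrum :: "('k \<Rightarrow> 'a::ring_1 \<Rightarrow> 'a) \<Rightarrow> 'a \<Rightarrow> 'k set" where
  "spectrum smul A = {z. \<not> invertible_element (smul z 1 - A)}"

definition resolvent :: "('k \<Rightarrow> 'a::ring_1 \<Rightarrow> 'a) \<Rightarrow> 'k \<Rightarrow> 'a \<Rightarrow> 'a" where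
  "resolvent smul z A = (THE y. (smul z 1 - A) * y = 1 \<and> y * (smul z 1 - A) = 1)"

definition algebra_hom_to_operators ::
  "('k \<Rightarrow> 'a::ring_1 \<Rightarrow> 'a) \<Rightarrow> ('k \<Rightarrow> 'x::ab_group_add \<Rightarrow> 'x) \<Rightarrow> 'x set \<Rightarrow> ('x \<Rightarrow> real) \<Rightarrow>
   ('a \<Rightarrow> 'x \<Rightarrow> 'x) \<Rightarrow> bool" where
  "algebra_hom_to_operators smul s V nV \<theta> \<longleftrightarrow>
     (\<forall>a. \<theta> a \<in> operators s V nV) \<and>
     (\<forall>a b. \<theta> (a + b) = (\<lambda>x\<in>V. \<theta> a x + \<theta> b x)) \<and>
     (\<forall>c a. \<theta> (smul c a) = (\<lambda>x\<in>V. s c (\<theta> a x))) \<and>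
     (\<forall>a b. \<theta> (a * b) = compose V (\<theta> a) (\<theta> b)) \<and>
     \<theta> 1 = (\<lambda>x\<in>V. x)"

definition space_analytic ::
  "('k::ultranormed_field \<Rightarrow> 'a::{ring_1, pnormed} \<Rightarrow> 'a) \<Rightarrow>
   ('k \<Rightarrow> 'x::ab_group_add \<Rightarrow> 'x) \<Rightarrow> 'x set \<Rightarrow> ('x \<Rightarrow> real) \<Rightarrow> 'a \<Rightarrow> bool" where
  "space_analytic smul s V nV A \<longleftrightarrow>
     compact (spectrum smul A) \<and>
     (\<exists>\<theta>. algebra_hom_to_operators smul s V nV \<theta> \<and> inj \<theta> \<and>
          continuous_map euclidean (op_topology s V nV) \<theta> \<and>
          continuous_map (subtopology (op_topology s V nV) (range \<theta>)) euclidean (inv \<theta>) \<and>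
          analytic_operator s V nV (\<theta> A))"

text \<open>The type arguments are universes for the Banach spaces and for the index sets \<open>J k\<close>.  A theorem
  that assumes \<open>algebra_analytic\<close> and is polymorphic in \<open>'x\<close> and \<open>'j\<close> holds for all possible choices.\<close>

definition algebra_analytic ::
  "'x::ab_group_add itself \<Rightarrow> 'j itself \<Rightarrow>
   ('k::ultranormed_field \<Rightarrow> 'a::{ring_1, pnormed} \<Rightarrow> 'a) \<Rightarrow> 'a \<Rightarrow> bool" where
  "algebra_analytic X_type J_type smul A \<longleftrightarrow>
     (\<exists>(A' :: nat \<Rightarrow> 'a) (s :: nat \<Rightarrow> 'k \<Rightarrow> 'x \<Rightarrow> 'x) (V :: nat \<Rightarrow> 'x set)
        (nV :: nat \<Rightarrow> 'x \<Rightarrow> real) (J :: nat \<Rightarrow> 'j set).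
        (\<forall>k. padic_banach_space (s k) (V k) (nV k) \<and> J k \<noteq> {} \<and>
             banach_isomorphic (s k) (V k) (nV k)
               (fun_scale :: 'k \<Rightarrow> ('j \<Rightarrow> 'k) \<Rightarrow> 'j \<Rightarrow> 'k) (null_families (J k)) (null_norm (J k)) \<and>
             spectrum smul (A' k) \<noteq> {} \<and> compact (spectrum smul (A' k)) \<and>
             space_analytic smul (s k) (V k) (nV k) (A' k)) \<and>
        A' \<longlonglongrightarrow> A)"

section \<open>The Shnirelman integral and the functional calculus\<close>

definition prime_to :: "nat \<Rightarrow> nat filter" where
  "prime_to p = inf sequentially (principal {n. \<not> p dvd n})"

definition shnirelman_average ::
  "('k::ultranormed_field \<Rightarrow> 'a::ab_group_add \<Rightarrow> 'a) \<Rightarrow> 'k \<Rightarrow> 'k \<Rightarrow> ('k \<Rightarrow> 'a) \<Rightarrow> nat \<Rightarrow> 'a" where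
  "shnirelman_average smul a \<Gamma> F n =
     smul (1 / of_nat n) (\<Sum>\<xi> | \<xi> ^ n = 1. F (a + \<xi> * \<Gamma>))"

definition calculus_average ::
  "('k::ultranormed_field \<Rightarrow> 'a::ring_1 \<Rightarrow> 'a) \<Rightarrow> 'a \<Rightarrow> ('k \<Rightarrow> 'k) \<Rightarrow> nat \<Rightarrow> (nat \<Rightarrow> 'k) \<Rightarrow> 'k \<Rightarrow> nat \<Rightarrow> 'a"
  where
  "calculus_average smul A f N a \<Gamma> n =
     (\<Sum>i = 1..N. shnirelman_average smul (a i) \<Gamma>
        (\<lambda>x. smul (f x * (x - a i)) (resolvent smul x A)) n)"

text \<open>The sum of Shnirelman integrals that defines \<open>f(A)\<close>, for one choice of discs.\<close>

definition calculus_integral ::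
  "nat \<Rightarrow> ('k::ultranormed_field \<Rightarrow> 'a::{ring_1, pnormed} \<Rightarrow> 'a) \<Rightarrow> 'a \<Rightarrow> ('k \<Rightarrow> 'k) \<Rightarrow>
   nat \<Rightarrow> (nat \<Rightarrow> 'k) \<Rightarrow> 'k \<Rightarrow> 'a" where
  "calculus_integral p smul A f N a \<Gamma> = Lim (prime_to p) (calculus_average smul A f N a \<Gamma>)"

definition has_calculus_value ::
  "nat \<Rightarrow> ('k::ultranormed_field \<Rightarrow> 'a::{ring_1, pnormed} \<Rightarrow> 'a) \<Rightarrow> 'a \<Rightarrow> ('k \<Rightarrow> 'k) \<Rightarrow> 'a \<Rightarrow> bool"
  where
  "has_calculus_value p smul A f y \<longleftrightarrow>
     (\<forall>N a r \<Gamma>. admissible (spectrum smul A) f N a r \<and> pnorm \<Gamma> = r \<longrightarrow>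
        (calculus_average smul A f N a \<Gamma> \<longlongrightarrow> y) (prime_to p))"

text \<open>The element \<open>f(A)\<close>.\<close>

definition calculus ::
  "nat \<Rightarrow> ('k::ultranormed_field \<Rightarrow> 'a::{ring_1, pnormed} \<Rightarrow> 'a) \<Rightarrow> 'a \<Rightarrow> ('k \<Rightarrow> 'k) \<Rightarrow> 'a" where
  "calculus p smul A f = (THE y. has_calculus_value p smul A f y)"

text \<open>For every \<open>f\<close> that is locally analytic on the spectrum, the limit defining \<open>f(A)\<close> exists and does
  not depend on the choice of the discs and of \<open>\<Gamma>\<close>; without this \<open>calculus\<close> is meaningless.\<close>

definition calculus_well_defined ::
  "nat \<Rightarrow> ('k::ultranormed_field \<Rightarrow> 'a::{ring_1, pnormed} \<Rightarrow> 'a) \<Rightarrow> 'a \<Rightarrow> bool" where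
  "calculus_well_defined p smul A \<longleftrightarrow>
     (\<forall>f\<in>L_space (spectrum smul A). \<exists>y. has_calculus_value p smul A f y)"

end

theory Submission
  imports Defs
begin

text \<open>A function that is Krasner analytic on each disc of a finite disjoint family of the same radius
  is a uniform limit of polynomials on their union.  The averages defining \<open>h(A)\<close> satisfy
  \<open>(xh)(A) = A h(A)\<close> in the limit, because \<open>x R(x) = 1 + A R(x)\<close> and the scalar integral of
  \<open>h(x) (x - a)\<close> vanishes; computing on one huge circle gives \<open>1(A) = 1\<close>, since the integral does not
  depend on the discs.  Hence \<open>(Ph)(A) = P(A) h(A)\<close> for polynomials \<open>P\<close>.  The averages are bounded
  operators that converge pointwise, so by uniform boundedness \<open>h \<mapsto> h(A)\<close> is continuous for uniform
  convergence on the discs.  This is (iii), and with the density of polynomials it gives (ii).\<close>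

section \<open>Non-Archimedean norms\<close>

text \<open>Circles in \<open>Omega_p\<close> are not compact, so the resolvent has no evident bound
  on them, and the averages have none that is uniform in their order. A single average involves
  finitely many resolvents and is bounded; uniformity has to come from convergence, by a gliding
  hump. This requires functions analytic on the discs to be closed under uniform limits. Krasner
  analyticity is therefore handled as uniform approximability by polynomials, which passes to
  limits, products and smaller discs; the way back to a power series rests on
  \<open>poly_coeff_bound\<close>, which controls coefficients by values. Multiplicativity is
  obtained for polynomials, so one polynomial has to approximate on all discs at once; it is glued
  by polynomials near 1 on one disc and near 0 on the others. No single disc system serves all
  claims: \<open>g\<close> may need smaller discs than \<open>f\<close>, and members of
  \<open>B_space\<close> are known to be analytic only on discs inside \<open>nbhd\<close>. The
  calculus is therefore developed in \<open>disc_calculus\<close> for any system and instantiated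
  three times; \<open>has_calculus_value\<close> covers every admissible choice, so the values
  agree.\<close>

lemma pnorm_zero [simp]: "pnorm (0::'a::pnormed) = 0"
  using dist_pnorm[of "0::'a" 0] by simp

lemma pnorm_minus [simp]: "pnorm (- x) = pnorm (x::'a::pnormed)"
  using dist_pnorm[of 0 x] dist_pnorm[of x 0] by (simp add: dist_commute)

lemma pnorm_minus_commute: "pnorm (x - y) = pnorm (y - x :: 'a::pnormed)"
  using pnorm_minus[of "x - y"] by simp

lemma pnorm_ge_0 [simp]: "0 \<le> pnorm (x::'a::pnormed)"
  using dist_pnorm[of x 0] zero_le_dist[of x 0] by simp

lemma pnorm_eq_0_iff [simp]: "pnorm (x::'a::pnormed) = 0 \<longleftrightarrow> x = 0"
  using dist_pnorm[of x 0] by (metis diff_zero dist_eq_0_iff)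

lemma pnorm_pos_iff [simp]: "0 < pnorm (x::'a::pnormed) \<longleftrightarrow> x \<noteq> 0"
  using pnorm_ge_0[of x] by (auto simp: less_le simp del: pnorm_ge_0)

lemma pnorm_triangle: "pnorm (x + y) \<le> pnorm x + pnorm (y::'a::pnormed)"
  using dist_triangle[of x "- y" 0] by (simp add: dist_pnorm)

lemma pnorm_sum_le: "pnorm (\<Sum>i\<in>I. f i) \<le> (\<Sum>i\<in>I. pnorm (f i :: 'a::pnormed))"
proof (induction I rule: infinite_finite_induct)
  case (insert i I)
  then show ?case
    using pnorm_triangle[of "f i" "sum f I"] by simp
qed auto

text \<open>Makes the library's limit rules for sums and differences available both in the field and
  in the algebra.\<close>

instance pnormed \<subseteq> topological_ab_group_add
proof
  fix a b :: 'a
  have fst_lim: "(fst \<longlongrightarrow> a) (nhds a \<times>\<^sub>F nhds b)" and snd_lim: "(snd \<longlongrightarrow> b) (nhds a \<times>\<^sub>F nhds b)"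
    by (auto intro: filterlim_fst filterlim_snd)
  have "((\<lambda>x. dist (fst x) a + dist (snd x) b) \<longlongrightarrow> 0) (nhds a \<times>\<^sub>F nhds b)"
    using tendsto_add[OF tendsto_dist[OF fst_lim tendsto_const[of a]]
        tendsto_dist[OF snd_lim tendsto_const[of b]]] by simp
  moreover have "dist (fst x + snd x) (a + b) \<le> dist (fst x) a + dist (snd x) b" for x :: "'a \<times> 'a"
    using pnorm_triangle[of "fst x - a" "snd x - b"] by (simp add: dist_pnorm algebra_simps)
  ultimately have "((\<lambda>x. dist (fst x + snd x) (a + b)) \<longlongrightarrow> 0) (nhds a \<times>\<^sub>F nhds b)"
    by (elim tendsto_0_le[where K = 1]) simp
  then show "((\<lambda>x. fst x + snd x) \<longlongrightarrow> a + b) (nhds a \<times>\<^sub>F nhds b)"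
    by (subst tendsto_dist_iff)
  have "((\<lambda>x. dist x a) \<longlongrightarrow> 0) (nhds a)"
    using tendsto_dist[OF filterlim_ident[of "nhds a"] tendsto_const[of a]] by simp
  moreover have "dist (- x) (- a) = dist x a" for x :: 'a
    using pnorm_minus[of "x - a"] by (simp add: dist_pnorm)
  ultimately show "(uminus \<longlongrightarrow> - a) (nhds a)"
    by (subst tendsto_dist_iff) simp
qed

lemma tendsto_pnorm:
  "(f \<longlongrightarrow> l) F \<Longrightarrow> ((\<lambda>x. pnorm (f x :: 'a::pnormed)) \<longlongrightarrow> pnorm l) F"
  using tendsto_dist[of f l F "\<lambda>_. 0" 0] by (simp add: dist_pnorm)

lemma tendsto_pnorm_iff:
  "(f \<longlongrightarrow> l) F \<longleftrightarrow> ((\<lambda>x. pnorm (f x - l :: 'a::pnormed)) \<longlongrightarrow> 0) F"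
  by (subst tendsto_dist_iff) (simp add: dist_pnorm)

text \<open>The ultrametric inequality is a premise because \<open>pnormed\<close> does not contain
  it: for the field it is a class axiom, for the algebra it is \<open>algebra_ultra\<close>.\<close>

lemma sum_ultra_le:
  fixes f :: "'i \<Rightarrow> 'a::pnormed"
  assumes ultra: "\<And>x y :: 'a. pnorm (x + y) \<le> max (pnorm x) (pnorm y)"
    and "0 \<le> M" and "\<And>i. i \<in> I \<Longrightarrow> pnorm (f i) \<le> M"
  shows "pnorm (\<Sum>i\<in>I. f i) \<le> M"
  using assms(3)
proof (induction I rule: infinite_finite_induct)
  case (insert i I)
  then have "pnorm (f i) \<le> M" "pnorm (sum f I) \<le> M"
    by auto
  then have "pnorm (f i + sum f I) \<le> M"
    using ultra[of "f i" "sum f I"] by linarith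
  with insert.hyps show ?case
    by simp
qed (use \<open>0 \<le> M\<close> in auto)

lemmas pnorm_sum_ultra = sum_ultra_le[OF pnorm_ultra]

lemma pnorm_diff_ultra: "pnorm (x - y) \<le> max (pnorm x) (pnorm (y::'a::ultranormed_field))"
  using pnorm_ultra[of x "- y"] by simp

lemma pnorm_diff_le:
  "pnorm x \<le> e \<Longrightarrow> pnorm y \<le> e \<Longrightarrow> pnorm (x - y :: 'a::ultranormed_field) \<le> e"
  using pnorm_diff_ultra[of x y] by linarith

lemma pnorm_add_le:
  "pnorm x \<le> e \<Longrightarrow> pnorm y \<le> e \<Longrightarrow> pnorm (x + y :: 'a::ultranormed_field) \<le> e"
  using pnorm_ultra[of x y] by linarith

lemma pnorm_triangle_ultra:
  "pnorm (x - y) \<le> e \<Longrightarrow> pnorm (y - z) \<le> e \<Longrightarrow> pnorm (x - z :: 'a::ultranormed_field) \<le> e"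
  using pnorm_add_le[of "x - y" e "y - z"] by simp

lemma dist_ultra: "dist x z \<le> max (dist x y) (dist y (z::'a::ultranormed_field))"
  using pnorm_ultra[of "x - y" "y - z"] by (simp add: dist_pnorm)

lemma pnorm_one [simp]: "pnorm (1::'a::ultranormed_field) = 1"
  using pnorm_mult[of "1::'a" 1] by simp

lemma pnorm_power: "pnorm (x ^ n) = pnorm (x::'a::ultranormed_field) ^ n"
  by (induction n) (auto simp: pnorm_mult)

lemma pnorm_inverse: "pnorm (inverse x) = inverse (pnorm (x::'a::ultranormed_field))"
proof (cases "x = 0")
  case False
  then have "pnorm x * pnorm (inverse x) = 1"
    by (simp flip: pnorm_mult)
  then show ?thesis
    by (simp add: inverse_unique)
qed simp

lemma pnorm_divide: "pnorm (x / y) = pnorm x / pnorm (y::'a::ultranormed_field)"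
  by (simp add: divide_inverse pnorm_mult pnorm_inverse)

lemma pnorm_root_of_unity:
  assumes "\<xi> ^ n = (1::'a::ultranormed_field)" "n > 0"
  shows "pnorm \<xi> = 1"
proof -
  have "pnorm \<xi> ^ n = 1"
    using assms by (simp flip: pnorm_power)
  then show ?thesis
    using assms(2) power_eq_imp_eq_base[of "pnorm \<xi>" n 1] by simp
qed

instance ultranormed_field \<subseteq> topological_semigroup_mult
proof
  fix a b :: 'a
  have fst_lim: "(fst \<longlongrightarrow> a) (nhds a \<times>\<^sub>F nhds b)" and snd_lim: "(snd \<longlongrightarrow> b) (nhds a \<times>\<^sub>F nhds b)"
    by (auto intro: filterlim_fst filterlim_snd)
  have "((\<lambda>x. pnorm (fst x) * pnorm (snd x - b) + pnorm (fst x - a) * pnorm b) \<longlongrightarrow>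
          pnorm a * pnorm (b - b) + pnorm (a - a) * pnorm b) (nhds a \<times>\<^sub>F nhds b)"
    by (intro tendsto_intros tendsto_pnorm fst_lim snd_lim)
  then have "((\<lambda>x. pnorm (fst x) * pnorm (snd x - b) + pnorm (fst x - a) * pnorm b) \<longlongrightarrow> 0)
      (nhds a \<times>\<^sub>F nhds b)"
    by simp
  moreover have "pnorm (fst x * snd x - a * b) \<le>
      pnorm (fst x) * pnorm (snd x - b) + pnorm (fst x - a) * pnorm b" for x :: "'a \<times> 'a"
    using pnorm_triangle[of "fst x * (snd x - b)" "(fst x - a) * b"]
    by (simp add: algebra_simps flip: pnorm_mult)
  ultimately have "((\<lambda>x. pnorm (fst x * snd x - a * b)) \<longlongrightarrow> 0) (nhds a \<times>\<^sub>F nhds b)"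
    by (elim tendsto_0_le[where K = 1]) (auto intro!: always_eventually order_trans[OF _ abs_ge_self])
  then show "((\<lambda>x. fst x * snd x) \<longlongrightarrow> a * b) (nhds a \<times>\<^sub>F nhds b)"
    by (subst tendsto_pnorm_iff)
qed

section \<open>Roots of unity\<close>

context Omega_p
begin

lemma p_gt_1: "1 < p"
  using prime_p by (rule prime_gt_1_nat)

lemma pnorm_of_nat_coprime: "\<not> p dvd n \<Longrightarrow> pnorm (of_nat n :: 'k) = 1"
  using pnorm_of_int[of "int n"] by (cases "n = 0") (auto simp: not_dvd_imp_multiplicity_0)

lemma pnorm_p: "pnorm (of_nat p :: 'k) = 1 / real p"
  using pnorm_of_int[of "int p"] p_gt_1 prime_p by simp

lemma exists_small_scalar: "\<exists>c::'k. c \<noteq> 0 \<and> pnorm c < 1"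
proof -
  have "pnorm (of_nat p :: 'k) < 1"
    using pnorm_p p_gt_1 by simp
  then show ?thesis
    using p_gt_1 by (intro exI[of _ "of_nat p"]) simp
qed

lemma exists_large_scalar: "\<exists>c::'k. b < pnorm c"
proof -
  obtain c :: 'k where c: "c \<noteq> 0" "pnorm c < 1"
    using exists_small_scalar by blast
  obtain n where "b < (1 / pnorm c) ^ n"
    using real_arch_pow[of "1 / pnorm c" b] c by auto
  then show ?thesis
    by (intro exI[of _ "(1 / c) ^ n"]) (simp add: pnorm_power pnorm_divide)
qed

text \<open>Any prime other than \<open>p\<close> would serve.\<close>

definition aux_prime :: nat where
  "aux_prime = (if p = 2 then 3 else 2)"

lemma prime_aux_prime: "prime aux_prime"
  unfolding aux_prime_def by simp

lemma p_not_dvd_aux_prime_power: "\<not> p dvd aux_prime ^ e"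
proof
  assume "p dvd aux_prime ^ e"
  then have "p dvd aux_prime"
    using prime_p by (metis prime_dvd_power)
  then have "p = aux_prime"
    by (rule primes_dvd_imp_eq[OF prime_p prime_aux_prime])
  moreover have "aux_prime \<noteq> p"
    by (simp add: aux_prime_def)
  ultimately show False
    by simp
qed

lemma filterlim_aux_prime_power: "filterlim (\<lambda>e. aux_prime ^ e) (prime_to p) sequentially"
proof -
  have "filterlim (\<lambda>e. aux_prime ^ e) at_top sequentially"
    by (intro filterlim_at_top_mono[OF filterlim_ident] always_eventually allI less_imp_le
        power_gt_expt) (simp add: aux_prime_def)
  then show ?thesis
    unfolding prime_to_def
    by (auto simp: filterlim_inf filterlim_principal p_not_dvd_aux_prime_power)
qed

text \<open>Uniqueness of limits over \<open>prime_to p\<close> depends on this. The powers of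
  \<open>aux_prime\<close> tend to infinity inside the filter, so it is proper.\<close>

lemma prime_to_neq_bot: "prime_to p \<noteq> bot"
proof
  assume "prime_to p = bot"
  then have "eventually (\<lambda>_::nat. False) sequentially"
    using filterlim_aux_prime_power
    by (auto simp: filterlim_def bot.extremum_unique filtermap_bot_iff)
  then show False
    by simp
qed

section \<open>Roots of unity of prime power order\<close>

lemma zero_one_in_Qp_alg: "0 \<in> (Qp_alg :: 'k set)" "1 \<in> (Qp_alg :: 'k set)"
proof -
  have Rats_Qp: "x \<in> \<rat> \<Longrightarrow> x \<in> Qp" for x :: 'k
    using closure_subset[of "\<rat> :: 'k set"] by (auto simp: Qp_def)
  have "x \<in> Qp_alg" if "x \<in> \<rat>" for x :: 'k
    unfolding Qp_alg_def mem_Collect_eq using that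
    by (intro exI[of _ "[:- x, 1:]"]) (auto simp: coeff_pCons intro!: Rats_Qp split: nat.splits)
  then show "0 \<in> (Qp_alg :: 'k set)" "1 \<in> (Qp_alg :: 'k set)"
    by auto
qed

text \<open>Only polynomials with algebraic coefficients are known to have roots, and dividing \<open>X ^ n - 1\<close> by
  its roots would leave the known ones.  A root of the cyclotomic polynomial of a prime power order
  is found in one step, and orders that are powers of one prime other than \<open>p\<close> suffice: the limits
  over \<open>prime_to p\<close> are known to exist, so they may be computed along these orders.\<close>

lemma exists_primitive_root:
  "\<exists>\<zeta>::'k. \<zeta> ^ (aux_prime ^ Suc e) = 1 \<and> \<zeta> ^ (aux_prime ^ e) \<noteq> 1"
proof -
  define q m where "q = aux_prime" and "m = q ^ e"
  have q: "q > 1"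
    using prime_aux_prime prime_gt_1_nat q_def by blast
  then have m: "m > 0"
    by (simp add: m_def)
  \<comment> \<open>This is the cyclotomic polynomial of order \<open>q ^ Suc e\<close>, the
    quotient of X^(qm) - 1 by X^m - 1; its coefficients are only 0 and 1.\<close>
  define Q :: "'k poly" where "Q = (\<Sum>i<q. monom 1 (i * m))"
  have coeff_Q: "coeff Q k = (\<Sum>i<q. if i * m = k then 1 else 0)" for k
    by (simp add: Q_def coeff_sum)
  have "coeff Q k = (if k \<in> (\<lambda>i. i * m) ` {..<q} then 1 else 0)" for k
  proof (cases "k \<in> (\<lambda>i. i * m) ` {..<q}")
    case True
    then obtain i where i: "i < q" "k = i * m"
      by auto
    then have "coeff Q k = (\<Sum>j<q. if j = i then 1 else 0)"
      using m by (simp add: coeff_Q)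
    with i True show ?thesis
      by simp
  qed (auto simp: coeff_Q intro!: sum.neutral)
  moreover from this[of m] have "coeff Q m = 1"
    using q by (auto intro!: image_eqI[of _ _ 1])
  ultimately have "\<forall>i. coeff Q i \<in> Qp_alg" "degree Q > 0"
    using zero_one_in_Qp_alg le_degree[of Q m] m by auto
  then obtain \<zeta> where \<zeta>: "poly Q \<zeta> = 0"
    using Qp_alg_closed[of Q] by blast
  define w where "w = \<zeta> ^ m"
  have geo: "(\<Sum>i<q. w ^ i) = 0"
    using \<zeta> by (simp add: Q_def w_def poly_sum poly_monom mult.commute flip: power_mult)
  have "w ^ q = 1"
    using geo power_diff_1_eq[of w q] by simp
  \<comment> \<open>For \<open>w = 1\<close> the geometric sum would be \<open>q\<close>, which is
    nonzero in characteristic 0.\<close>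
  moreover have "w \<noteq> 1"
    using geo q by auto
  ultimately show ?thesis
    unfolding w_def by (intro exI[of _ \<zeta>]) (auto simp: q_def m_def mult.commute simp flip: power_mult)
qed

text \<open>By Bezout the gcd \<open>d\<close> of \<open>k\<close> and the prime power again
  satisfies \<open>\<zeta> ^ d = 1\<close>. A proper divisor of a prime power divides the next lower
  power, where \<zeta> does not give 1.\<close>

lemma primitive_root_dvd:
  assumes "(\<zeta>::'k) ^ (aux_prime ^ Suc e) = 1" "\<zeta> ^ (aux_prime ^ e) \<noteq> 1" "\<zeta> ^ k = 1"
  shows "aux_prime ^ Suc e dvd k"
proof (rule ccontr)
  assume not_dvd: "\<not> aux_prime ^ Suc e dvd k"
  then have k: "k \<noteq> 0"
    by (metis dvd_0_right)
  define d where "d = gcd k (aux_prime ^ Suc e)"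
  obtain x y where xy: "k * x = aux_prime ^ Suc e * y + d"
    using bezout_nat[OF k] d_def by blast
  have "\<zeta> ^ (k * x) = \<zeta> ^ (aux_prime ^ Suc e * y) * \<zeta> ^ d"
    by (simp add: xy power_add)
  then have d1: "\<zeta> ^ d = 1"
    using assms by (simp add: power_mult del: power_Suc)
  have "d dvd aux_prime ^ Suc e"
    by (simp add: d_def del: power_Suc)
  then obtain i where i: "i \<le> Suc e" "d = aux_prime ^ i"
    using divides_primepow_nat[OF prime_aux_prime] by blast
  have "i \<noteq> Suc e"
    using not_dvd i d_def by (metis gcd_dvd1)
  then have "d dvd aux_prime ^ e"
    using i by (simp add: le_imp_power_dvd)
  then show False
    using d1 assms(2) by (metis dvdE power_mult power_one)
qed

lemma finite_roots_of_unity: "n > 0 \<Longrightarrow> finite {\<xi>::'k. \<xi> ^ n = 1}"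
  and card_roots_of_unity_le: "n > 0 \<Longrightarrow> card {\<xi>::'k. \<xi> ^ n = 1} \<le> n"
proof -
  assume n: "n > 0"
  define Q :: "'k poly" where "Q = monom 1 n + [:- 1:]"
  have deg: "degree Q = n"
    unfolding Q_def using n by (subst degree_add_eq_left) (auto simp: degree_monom_eq)
  with n have "Q \<noteq> 0"
    by auto
  moreover have "{\<xi>. \<xi> ^ n = 1} = {x. poly Q x = 0}"
    by (auto simp: Q_def poly_monom)
  ultimately show "finite {\<xi>::'k. \<xi> ^ n = 1}" "card {\<xi>::'k. \<xi> ^ n = 1} \<le> n"
    using card_poly_roots_bound[of Q] deg poly_roots_finite[of Q] by auto
qed

text \<open>The powers of a primitive root give as many distinct roots as the degree of X^n - 1
  permits. The exact count is what makes the average of the constant 1 equal to 1.\<close>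

lemma card_roots_of_unity: "card {\<xi>::'k. \<xi> ^ (aux_prime ^ e) = 1} = aux_prime ^ e"
proof (cases e)
  case (Suc e')
  obtain \<zeta> :: 'k where \<zeta>: "\<zeta> ^ (aux_prime ^ Suc e') = 1" "\<zeta> ^ (aux_prime ^ e') \<noteq> 1"
    using exists_primitive_root by blast
  define n where "n = aux_prime ^ Suc e'"
  have n: "n > 0"
    using prime_aux_prime by (simp add: n_def prime_gt_0_nat)
  have \<zeta>n: "\<zeta> ^ n = 1"
    using \<zeta> by (simp add: n_def)
  with n have "\<zeta> \<noteq> 0"
    by (metis power_0_left not_gr0 zero_neq_one)
  have neq: "\<zeta> ^ i \<noteq> \<zeta> ^ j" if "i < j" "j < n" for i j
  proof
    assume "\<zeta> ^ i = \<zeta> ^ j"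
    moreover have "\<zeta> ^ j = \<zeta> ^ i * \<zeta> ^ (j - i)"
      using that by (simp flip: power_add)
    ultimately have "\<zeta> ^ i * \<zeta> ^ (j - i) = \<zeta> ^ i * 1"
      by simp
    then have "n dvd j - i"
      using \<open>\<zeta> \<noteq> 0\<close> primitive_root_dvd[OF \<zeta>] by (simp add: n_def del: power_Suc)
    with that show False
      by (auto dest: dvd_imp_le)
  qed
  then have "inj_on (\<lambda>k. \<zeta> ^ k) {..<n}"
    by (intro linorder_inj_onI) auto
  moreover have "(\<zeta> ^ k) ^ n = 1" for k
    using \<zeta>n by (metis mult.commute power_mult power_one)
  then have "(\<lambda>k. \<zeta> ^ k) ` {..<n} \<subseteq> {\<xi>. \<xi> ^ n = 1}"
    by auto
  ultimately have "n \<le> card {\<xi>::'k. \<xi> ^ n = 1}"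
    using card_inj_on_le finite_roots_of_unity[OF n] by (metis card_lessThan)
  then show ?thesis
    using card_roots_of_unity_le[OF n] Suc by (simp add: n_def)
qed simp

text \<open>Multiplication by a primitive root \<zeta> permutes the roots, so the sum is unchanged
  by the factor \<open>\<zeta> ^ k\<close>, which differs from 1.\<close>

lemma sum_roots_of_unity:
  assumes "\<not> aux_prime ^ Suc e dvd k"
  shows "(\<Sum>\<xi> | \<xi> ^ (aux_prime ^ Suc e) = 1. (\<xi>::'k) ^ k) = 0"
proof -
  obtain \<zeta> :: 'k where \<zeta>: "\<zeta> ^ (aux_prime ^ Suc e) = 1" "\<zeta> ^ (aux_prime ^ e) \<noteq> 1"
    using exists_primitive_root by blast
  define n where "n = aux_prime ^ Suc e"
  have "\<zeta> ^ n = 1"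
    using \<zeta> by (simp add: n_def)
  moreover have "n > 0"
    using prime_aux_prime by (simp add: n_def prime_gt_0_nat)
  ultimately have "\<zeta> \<noteq> 0"
    by (metis power_0_left not_gr0 zero_neq_one)
  with \<open>\<zeta> ^ n = 1\<close> have "bij_betw ((*) \<zeta>) {\<xi>. \<xi> ^ n = 1} {\<xi>. \<xi> ^ n = 1}"
    by (intro bij_betw_byWitness[where f' = "\<lambda>\<xi>. \<xi> / \<zeta>"])
      (auto simp: power_mult_distrib power_divide)
  then have "(\<Sum>\<xi> | \<xi> ^ n = 1. \<xi> ^ k) = (\<Sum>\<xi> | \<xi> ^ n = 1. (\<zeta> * \<xi>) ^ k)"
    by (rule sum.reindex_bij_betw[symmetric])
  also have "\<dots> = \<zeta> ^ k * (\<Sum>\<xi> | \<xi> ^ n = 1. \<xi> ^ k)"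
    by (simp add: power_mult_distrib sum_distrib_left)
  finally have "(1 - \<zeta> ^ k) * (\<Sum>\<xi> | \<xi> ^ n = 1. \<xi> ^ k) = 0"
    by (simp add: algebra_simps)
  moreover have "\<zeta> ^ k \<noteq> 1"
    using primitive_root_dvd[OF \<zeta>] assms by blast
  ultimately show ?thesis
    by (simp add: n_def)
qed

end

section \<open>Krasner analytic functions as uniform limits of polynomials\<close>

text \<open>By the ultrametric inequality a tail is at most its largest term, so terms tending to 0
  already give uniform convergence.\<close>

lemma krasner_partial_sum_approx:
  fixes f :: "'k::ultranormed_field \<Rightarrow> 'k"
  assumes c: "(\<lambda>k. r ^ k * pnorm (c k)) \<longlonglongrightarrow> 0"
    and sums: "\<And>x. x \<in> cball a r \<Longrightarrow> (\<lambda>k. c k * (x - a) ^ k) sums f x"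
    and "\<epsilon> > 0"
  shows "\<exists>m. \<forall>x\<in>cball a r. pnorm (f x - (\<Sum>k<m. c k * (x - a) ^ k)) \<le> \<epsilon>"
proof -
  obtain m where m: "\<And>k. k \<ge> m \<Longrightarrow> r ^ k * pnorm (c k) < \<epsilon>"
    using order_tendstoD(2)[OF c \<open>\<epsilon> > 0\<close>] by (auto simp: eventually_sequentially)
  have "pnorm (f x - (\<Sum>k<m. c k * (x - a) ^ k)) \<le> \<epsilon>" if x: "x \<in> cball a r" for x
  proof (rule tendsto_upperbound[OF tendsto_pnorm])
    show "(\<lambda>n. (\<Sum>k<n. c k * (x - a) ^ k) - (\<Sum>k<m. c k * (x - a) ^ k)) \<longlonglongrightarrow>
        f x - (\<Sum>k<m. c k * (x - a) ^ k)"
      using sums[OF x] by (intro tendsto_intros) (simp add: sums_def)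
    have "pnorm ((\<Sum>k<n. c k * (x - a) ^ k) - (\<Sum>k<m. c k * (x - a) ^ k)) \<le> \<epsilon>" if "n \<ge> m" for n
    proof -
      have "(\<Sum>k<n. c k * (x - a) ^ k) - (\<Sum>k<m. c k * (x - a) ^ k) = (\<Sum>k=m..<n. c k * (x - a) ^ k)"
        using that sum_diff_nat_ivl[of 0 m n] by (simp add: atLeast0LessThan)
      also have "pnorm \<dots> \<le> \<epsilon>"
      proof (rule pnorm_sum_ultra)
        fix k assume "k \<in> {m..<n}"
        have "pnorm (x - a) ^ k \<le> r ^ k"
          using x by (intro power_mono) (auto simp: dist_pnorm pnorm_minus_commute)
        then have "pnorm (c k * (x - a) ^ k) \<le> r ^ k * pnorm (c k)"
          by (simp add: pnorm_mult pnorm_power mult.commute mult_left_mono mult_right_mono)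
        also have "\<dots> \<le> \<epsilon>"
          using m[of k] \<open>k \<in> {m..<n}\<close> by simp
        finally show "pnorm (c k * (x - a) ^ k) \<le> \<epsilon>" .
      qed (use \<open>\<epsilon> > 0\<close> in simp)
      finally show ?thesis .
    qed
    then show "\<forall>\<^sub>F n in sequentially.
        pnorm ((\<Sum>k<n. c k * (x - a) ^ k) - (\<Sum>k<m. c k * (x - a) ^ k)) \<le> \<epsilon>"
      by (auto simp: eventually_sequentially)
  qed simp
  then show ?thesis
    by blast
qed

lemma krasner_imp_poly_approx:
  fixes f :: "'k::ultranormed_field \<Rightarrow> 'k"
  assumes "krasner_analytic f a r" and "\<epsilon> > 0"
  shows "\<exists>P. \<forall>x\<in>cball a r. pnorm (f x - poly P x) \<le> \<epsilon>"
proof -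
  obtain c where c: "(\<lambda>k. r ^ k * pnorm (c k)) \<longlonglongrightarrow> 0"
    and sums: "\<And>x. x \<in> cball a r \<Longrightarrow> (\<lambda>k. c k * (x - a) ^ k) sums f x"
    using assms(1) by (auto simp: krasner_analytic_def)
  obtain m where m: "\<forall>x\<in>cball a r. pnorm (f x - (\<Sum>k<m. c k * (x - a) ^ k)) \<le> \<epsilon>"
    using krasner_partial_sum_approx[OF c sums assms(2)] by blast
  have "poly (pcompose (\<Sum>k<m. monom (c k) k) [:- a, 1:]) x = (\<Sum>k<m. c k * (x - a) ^ k)" for x
    by (simp add: poly_pcompose poly_sum poly_monom)
  with m show ?thesis
    by (intro exI[of _ "pcompose (\<Sum>k<m. monom (c k) k) [:- a, 1:]"]) simp
qed

section \<open>From polynomial approximation back to power series\<close>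

context Omega_p
begin

lemma pnorm_aux_prime_power: "pnorm (of_nat (aux_prime ^ e) :: 'k) = 1"
  by (intro pnorm_of_nat_coprime p_not_dvd_aux_prime_power)

text \<open>The number l + (n - k) lies strictly between 0 and 2n, so n is its only possible value
  among the multiples of n. The shift by n - k stands for the exponent -k when a coefficient is
  extracted.\<close>

lemma dvd_add_diff_iff:
  fixes k l d n :: nat
  assumes "k \<le> d" "l \<le> d" "d < n"
  shows "n dvd (l + (n - k)) \<longleftrightarrow> l = k"
proof
  assume "n dvd (l + (n - k))"
  then obtain j where j: "l + (n - k) = n * j"
    by (rule dvdE)
  have "0 < n * j" "n * j < n * 2"
    unfolding j[symmetric] using assms by linarith+
  then have "j = 1"
    by (cases j; cases "j - 1") auto
  with j have "l + (n - k) = n"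
    by simp
  then show "l = k"
    using assms by linarith
next
  assume "l = k"
  then have "l + (n - k) = n"
    using assms by linarith
  then show "n dvd (l + (n - k))"
    by simp
qed

text \<open>Averaging over the roots of unity of large order extracts a coefficient.\<close>

lemma poly_coeff_bound:
  fixes Q :: "'k poly" and \<Gamma> :: 'k
  assumes bound: "\<And>t. pnorm t \<le> pnorm \<Gamma> \<Longrightarrow> pnorm (poly Q t) \<le> M"
  shows "pnorm \<Gamma> ^ k * pnorm (coeff Q k) \<le> M"
proof (cases "k \<le> degree Q")
  case False
  have "0 \<le> M"
    using order_trans[OF pnorm_ge_0 bound[of 0]] by simp
  with False show ?thesis
    by (simp add: coeff_eq_0)
next
  case True
  have "1 < aux_prime"
    using prime_aux_prime prime_gt_1_nat by blast
  then obtain e where e: "degree Q < aux_prime ^ e"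
    using power_gt_expt[of aux_prime "degree Q"] that[of "degree Q"] by simp
  \<comment> \<open>The order exceeds the degree, so that no two exponents of \<open>Q\<close> agree
    modulo \<open>n\<close>; the extra factor gives it the form required by
    \<open>sum_roots_of_unity\<close>.\<close>
  define n where "n = aux_prime ^ Suc e"
  have n: "degree Q < n" "n > 0"
    using e \<open>1 < aux_prime\<close> by (auto simp: n_def intro: less_le_trans)
  \<comment> \<open>The factor \<open>\<xi> ^ (n - k)\<close> is the inverse of
    \<open>\<xi> ^ k\<close>. Only the term of degree \<open>k\<close> survives, multiplied by
    \<open>n\<close>, and division by \<open>n\<close> is harmless because it has norm 1.\<close>
  have "(\<Sum>\<xi> | \<xi> ^ n = 1. poly Q (\<xi> * \<Gamma>) * \<xi> ^ (n - k)) =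
      (\<Sum>\<xi> | \<xi> ^ n = 1. \<Sum>l\<le>degree Q. coeff Q l * \<Gamma> ^ l * \<xi> ^ (l + (n - k)))"
    unfolding poly_altdef sum_distrib_right
    by (intro sum.cong refl) (simp add: power_mult_distrib power_add mult_ac)
  also have "\<dots> = (\<Sum>l\<le>degree Q. coeff Q l * \<Gamma> ^ l * (\<Sum>\<xi> | \<xi> ^ n = 1. \<xi> ^ (l + (n - k))))"
    by (subst sum.swap) (simp add: sum_distrib_left)
  also have "\<dots> = (\<Sum>l\<le>degree Q. if l = k then coeff Q k * \<Gamma> ^ k * of_nat n else 0)"
  proof (rule sum.cong)
    fix l assume "l \<in> {..degree Q}"
    then have "n dvd (l + (n - k)) \<longleftrightarrow> l = k"
      using True n by (intro dvd_add_diff_iff[of _ "degree Q"]) auto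
    moreover have "(\<Sum>\<xi> | \<xi> ^ n = 1. (\<xi>::'k) ^ (k + (n - k))) = of_nat n"
      using True n card_roots_of_unity[of "Suc e"] by (simp add: n_def)
    ultimately show "coeff Q l * \<Gamma> ^ l * (\<Sum>\<xi> | \<xi> ^ n = 1. \<xi> ^ (l + (n - k))) =
        (if l = k then coeff Q k * \<Gamma> ^ k * of_nat n else 0)"
      using sum_roots_of_unity[of e "l + (n - k)"] by (auto simp: n_def)
  qed simp
  also have "\<dots> = coeff Q k * \<Gamma> ^ k * of_nat n"
    using True by simp
  finally have "coeff Q k * \<Gamma> ^ k * of_nat n = (\<Sum>\<xi> | \<xi> ^ n = 1. poly Q (\<xi> * \<Gamma>) * \<xi> ^ (n - k))"
    by simp
  moreover have "pnorm (\<Sum>\<xi> | \<xi> ^ n = 1. poly Q (\<xi> * \<Gamma>) * \<xi> ^ (n - k)) \<le> M"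
  proof (rule pnorm_sum_ultra)
    fix \<xi> :: 'k assume "\<xi> \<in> {\<xi>. \<xi> ^ n = 1}"
    then have "pnorm \<xi> = 1"
      using n by (auto intro: pnorm_root_of_unity)
    then show "pnorm (poly Q (\<xi> * \<Gamma>) * \<xi> ^ (n - k)) \<le> M"
      using bound[of "\<xi> * \<Gamma>"] by (simp add: pnorm_mult pnorm_power)
  qed (use order_trans[OF pnorm_ge_0 bound[of 0]] in simp)
  ultimately have "pnorm (coeff Q k * \<Gamma> ^ k * of_nat n) \<le> M"
    by simp
  then show ?thesis
    using pnorm_aux_prime_power[of "Suc e"]
    by (simp add: pnorm_mult pnorm_power n_def mult.commute del: power_Suc of_nat_power)
qed

text \<open>The approximating polynomials are Cauchy for the supremum on the disc. By
  \<open>poly_coeff_bound\<close> their coefficients, weighted by r^k, are then Cauchy at a rate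
  independent of k, and this uniformity lets the limit coefficients define a series with sum
  \<open>f\<close>. The scalar \<Gamma> of norm r provides the circle on which coefficients are
  extracted.\<close>

lemma krasner_if_poly_approx:
  fixes f :: "'k \<Rightarrow> 'k" and \<Gamma> :: 'k
  assumes \<Gamma>: "\<Gamma> \<noteq> 0" "pnorm \<Gamma> = r"
    and approx: "\<And>\<epsilon>. \<epsilon> > 0 \<Longrightarrow> \<exists>P. \<forall>x\<in>cball a r. pnorm (f x - poly P x) \<le> \<epsilon>"
  shows "krasner_analytic f a r"
proof -
  have r: "r > 0"
    using \<Gamma> by auto
  define \<delta> where "\<delta> j = 1 / real (Suc j)" for j
  have \<delta>_pos: "\<delta> j > 0" for j
    by (simp add: \<delta>_def)
  have \<delta>_mono: "\<delta> i \<le> \<delta> j" if "j \<le> i" for i j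
    using that by (simp add: \<delta>_def frac_le)
  have \<delta>_lim: "\<delta> \<longlonglongrightarrow> 0"
    unfolding \<delta>_def using LIMSEQ_inverse_real_of_nat by (simp add: inverse_eq_divide)
  have \<delta>_ex: "\<exists>j. \<delta> j < \<epsilon>" if "\<epsilon> > 0" for \<epsilon>
    using order_tendstoD(2)[OF \<delta>_lim that] by (auto simp: eventually_sequentially)
  obtain P where P: "\<And>j x. x \<in> cball a r \<Longrightarrow> pnorm (f x - poly (P j) x) \<le> \<delta> j"
    using approx[OF \<delta>_pos] by metis
  define Q where "Q j = pcompose (P j) [:a, 1:]" for j
  have Q: "pnorm (f (a + t) - poly (Q j) t) \<le> \<delta> j" if "pnorm t \<le> r" for t j
    using P[of "a + t" j] that by (simp add: Q_def poly_pcompose dist_pnorm add.commute)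
  have coeff_diff: "r ^ k * pnorm (coeff (Q i) k - coeff (Q j) k) \<le> \<delta> j" if "j \<le> i" for i j k
  proof -
    have "pnorm (poly (Q i - Q j) t) \<le> \<delta> j" if "pnorm t \<le> pnorm \<Gamma>" for t
    proof -
      have "pnorm (f (a + t) - poly (Q i) t) \<le> \<delta> j" "pnorm (f (a + t) - poly (Q j) t) \<le> \<delta> j"
        using Q[of t] that \<Gamma> \<delta>_mono[OF \<open>j \<le> i\<close>] by (auto intro: order_trans)
      then show ?thesis
        using pnorm_diff_le[of "f (a + t) - poly (Q j) t" "\<delta> j" "f (a + t) - poly (Q i) t"] by simp
    qed
    then show ?thesis
      using poly_coeff_bound[of \<Gamma> "Q i - Q j" "\<delta> j" k] \<Gamma> by simp
  qed
  have "\<exists>l. (\<lambda>j. coeff (Q j) k) \<longlonglongrightarrow> l" for k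
  proof -
    have "Cauchy (\<lambda>j. coeff (Q j) k)"
    proof (rule metric_CauchyI)
      fix \<epsilon> :: real assume "\<epsilon> > 0"
      then obtain j where j: "\<delta> j < \<epsilon> * r ^ k"
        using \<delta>_ex[of "\<epsilon> * r ^ k"] r by auto
      have "dist (coeff (Q m) k) (coeff (Q n) k) < \<epsilon>" if "m \<ge> j" "n \<ge> j" for m n
      proof -
        have "r ^ k * dist (coeff (Q i) k) (coeff (Q j) k) < r ^ k * \<epsilon>" if "i \<ge> j" for i
          using coeff_diff[OF that, of k] j by (simp add: dist_pnorm mult.commute)
        then have "dist (coeff (Q i) k) (coeff (Q j) k) < \<epsilon>" if "i \<ge> j" for i
          using r that by (simp add: mult_less_cancel_left_pos)
        then show ?thesis
          using that dist_ultra[of "coeff (Q m) k" "coeff (Q n) k" "coeff (Q j) k"]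
          by (simp add: dist_commute[of "coeff (Q j) k"] le_less_trans)
      qed
      then show "\<exists>M. \<forall>m\<ge>M. \<forall>n\<ge>M. dist (coeff (Q m) k) (coeff (Q n) k) < \<epsilon>"
        by blast
    qed
    then show ?thesis
      by (simp add: Cauchy_convergent_iff convergent_def)
  qed
  then obtain c where c: "\<And>k. (\<lambda>j. coeff (Q j) k) \<longlonglongrightarrow> c k"
    by metis
  have c_diff: "r ^ k * pnorm (c k - coeff (Q j) k) \<le> \<delta> j" for j k
  proof (rule tendsto_upperbound)
    show "(\<lambda>i. r ^ k * pnorm (coeff (Q i) k - coeff (Q j) k)) \<longlonglongrightarrow> r ^ k * pnorm (c k - coeff (Q j) k)"
      by (intro tendsto_intros tendsto_pnorm c)
    show "\<forall>\<^sub>F i in sequentially. r ^ k * pnorm (coeff (Q i) k - coeff (Q j) k) \<le> \<delta> j"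
      using coeff_diff by (auto simp: eventually_sequentially)
  qed simp
  show ?thesis
    unfolding krasner_analytic_def
  proof (intro exI[of _ c] conjI ballI)
    show "(\<lambda>k. r ^ k * pnorm (c k)) \<longlonglongrightarrow> 0"
    proof (rule LIMSEQ_I)
      fix \<epsilon> :: real assume "\<epsilon> > 0"
      then obtain j where j: "\<delta> j < \<epsilon>"
        using \<delta>_ex by blast
      \<comment> \<open>Beyond the degree the coefficients of \<open>Q j\<close> vanish, so
        \<open>c_diff\<close> bounds \<open>c k\<close> itself.\<close>
      have "norm (r ^ k * pnorm (c k) - 0) < \<epsilon>" if "k \<ge> Suc (degree (Q j))" for k
        using c_diff[of k j] that j r by (simp add: coeff_eq_0)
      then show "\<exists>n0. \<forall>k\<ge>n0. norm (r ^ k * pnorm (c k) - 0) < \<epsilon>"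
        by blast
    qed
    fix x assume x: "x \<in> cball a r"
    define t where "t = x - a"
    have t: "pnorm t \<le> r" "x = a + t"
      using x by (auto simp: t_def dist_pnorm pnorm_minus_commute)
    \<comment> \<open>Once \<open>n\<close> exceeds the degree, \<open>Q j\<close> is its own
      partial sum. The coefficientwise errors and the distance from \<open>Q j\<close> to
      \<open>f\<close> are all at most \<open>\<delta> j\<close>, and so is their ultrametric
      sum.\<close>
    have partial_sum: "pnorm ((\<Sum>k<n. c k * t ^ k) - f x) \<le> \<delta> j" if n: "n > degree (Q j)" for n j
    proof -
      have "poly (Q j) t = (\<Sum>k<n. coeff (Q j) k * t ^ k)"
        unfolding poly_altdef using n by (intro sum.mono_neutral_left) (auto simp: coeff_eq_0)
      then have "(\<Sum>k<n. c k * t ^ k) - poly (Q j) t = (\<Sum>k<n. (c k - coeff (Q j) k) * t ^ k)"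
        by (simp add: sum_subtractf algebra_simps)
      also have "pnorm \<dots> \<le> \<delta> j"
      proof (rule pnorm_sum_ultra)
        fix k
        have "pnorm ((c k - coeff (Q j) k) * t ^ k) \<le> r ^ k * pnorm (c k - coeff (Q j) k)"
          using power_mono[OF t(1) pnorm_ge_0, of k]
          by (simp add: pnorm_mult pnorm_power mult.commute mult_left_mono mult_right_mono)
        with c_diff[of k j] show "pnorm ((c k - coeff (Q j) k) * t ^ k) \<le> \<delta> j"
          by linarith
      qed (use \<delta>_pos[of j] in simp)
      finally show ?thesis
      proof (rule pnorm_triangle_ultra)
        show "pnorm (poly (Q j) t - f x) \<le> \<delta> j"
          using Q[OF t(1), of j] t(2) by (subst pnorm_minus_commute) simp
      qed
    qed
    have "\<exists>n0. \<forall>n\<ge>n0. dist (\<Sum>k<n. c k * t ^ k) (f x) < \<epsilon>" if "\<epsilon> > 0" for \<epsilon>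
    proof -
      obtain j where "\<delta> j < \<epsilon>"
        using \<delta>_ex[OF \<open>\<epsilon> > 0\<close>] by blast
      then show ?thesis
        by (intro exI[of _ "Suc (degree (Q j))"]) (auto simp: dist_pnorm intro!: le_less_trans[OF partial_sum])
    qed
    then show "(\<lambda>k. c k * (x - a) ^ k) sums f x"
      unfolding sums_def t_def[symmetric] by (rule metric_LIMSEQ_I)
  qed
qed

text \<open>This is the completeness that the gliding hump relies on.\<close>

lemma krasner_uniform_limit:
  fixes f :: "'k \<Rightarrow> 'k" and \<Gamma> :: 'k
  assumes "\<Gamma> \<noteq> 0" "pnorm \<Gamma> = r"
    and "\<And>\<epsilon>. \<epsilon> > 0 \<Longrightarrow> \<exists>g. krasner_analytic g a r \<and> (\<forall>x\<in>cball a r. pnorm (f x - g x) \<le> \<epsilon>)"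
  shows "krasner_analytic f a r"
proof (rule krasner_if_poly_approx[OF assms(1,2)])
  fix \<epsilon> :: real assume "\<epsilon> > 0"
  then obtain g P where "\<forall>x\<in>cball a r. pnorm (f x - g x) \<le> \<epsilon>" "\<forall>x\<in>cball a r. pnorm (g x - poly P x) \<le> \<epsilon>"
    using assms(3) krasner_imp_poly_approx by metis
  then show "\<exists>P. \<forall>x\<in>cball a r. pnorm (f x - poly P x) \<le> \<epsilon>"
    by (blast intro: pnorm_triangle_ultra)
qed

lemma krasner_poly:
  fixes P :: "'k poly" and \<Gamma> :: 'k
  assumes "\<Gamma> \<noteq> 0" "pnorm \<Gamma> = r"
  shows "krasner_analytic (poly P) a r"
  by (rule krasner_if_poly_approx[OF assms]) (auto intro!: exI[of _ P])

lemma krasner_cong: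
  assumes "krasner_analytic f a r" "\<And>x. x \<in> cball a r \<Longrightarrow> f x = g x"
  shows "krasner_analytic g a r"
  using assms by (auto simp: krasner_analytic_def)

text \<open>Recentring the power series is avoided: a polynomial approximation simply restricts to
  the smaller disc.\<close>

lemma krasner_subset:
  fixes f :: "'k \<Rightarrow> 'k" and \<Gamma> :: 'k
  assumes "krasner_analytic f a r" "cball b s \<subseteq> cball a r" "\<Gamma> \<noteq> 0" "pnorm \<Gamma> = s"
  shows "krasner_analytic f b s"
  using assms(2) krasner_imp_poly_approx[OF assms(1)]
  by (intro krasner_if_poly_approx[OF assms(3,4)]) blast

lemma krasner_bounded:
  fixes f :: "'k \<Rightarrow> 'k"
  assumes "krasner_analytic f a r"
  shows "\<exists>M>0. \<forall>x\<in>cball a r. pnorm (f x) \<le> M"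
proof -
  obtain P where P: "\<forall>x\<in>cball a r. pnorm (f x - poly P x) \<le> 1"
    using krasner_imp_poly_approx[OF assms, of 1] by auto
  define Q where "Q = pcompose P [:a, 1:]"
  \<comment> \<open>The absolute value keeps \<open>M\<close> nonnegative when \<open>r\<close> is
    negative and the disc is empty.\<close>
  define M where "M = (\<Sum>k\<le>degree Q. pnorm (coeff Q k) * \<bar>r\<bar> ^ k)"
  have "pnorm (f x) \<le> 1 + M" if x: "x \<in> cball a r" for x
  proof -
    have "poly P x = poly Q (x - a)"
      by (simp add: Q_def poly_pcompose)
    also have "pnorm \<dots> \<le> (\<Sum>k\<le>degree Q. pnorm (coeff Q k * (x - a) ^ k))"
      unfolding poly_altdef by (rule pnorm_sum_le)
    also have "\<dots> \<le> M"
      unfolding M_def pnorm_mult pnorm_power using x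
      by (intro sum_mono mult_left_mono power_mono) (auto simp: dist_pnorm pnorm_minus_commute)
    finally show ?thesis
      using P x pnorm_triangle[of "f x - poly P x" "poly P x"] by fastforce
  qed
  moreover have "1 + M > 0"
    unfolding M_def by (intro add_pos_nonneg sum_nonneg) auto
  ultimately show ?thesis
    by blast
qed

lemma krasner_add:
  fixes f g :: "'k \<Rightarrow> 'k" and \<Gamma> :: 'k
  assumes "krasner_analytic f a r" "krasner_analytic g a r" "\<Gamma> \<noteq> 0" "pnorm \<Gamma> = r"
  shows "krasner_analytic (\<lambda>x. f x + g x) a r"
proof (rule krasner_if_poly_approx[OF assms(3,4)])
  fix \<epsilon> :: real assume "\<epsilon> > 0"
  then obtain P Q where P: "\<forall>x\<in>cball a r. pnorm (f x - poly P x) \<le> \<epsilon>"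
    and Q: "\<forall>x\<in>cball a r. pnorm (g x - poly Q x) \<le> \<epsilon>"
    using assms(1,2)[THEN krasner_imp_poly_approx] by metis
  have "pnorm (f x + g x - poly (P + Q) x) \<le> \<epsilon>" if "x \<in> cball a r" for x
    using P Q that pnorm_add_le[of "f x - poly P x" \<epsilon> "g x - poly Q x"] by (simp add: algebra_simps)
  then show "\<exists>P. \<forall>x\<in>cball a r. pnorm (f x + g x - poly P x) \<le> \<epsilon>"
    by blast
qed

lemma krasner_mult:
  fixes f g :: "'k \<Rightarrow> 'k" and \<Gamma> :: 'k
  assumes "krasner_analytic f a r" "krasner_analytic g a r" "\<Gamma> \<noteq> 0" "pnorm \<Gamma> = r"
  shows "krasner_analytic (\<lambda>x. f x * g x) a r"
proof (rule krasner_if_poly_approx[OF assms(3,4)])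
  fix \<epsilon> :: real assume \<epsilon>: "\<epsilon> > 0"
  obtain M where M: "M > 0" "\<And>x. x \<in> cball a r \<Longrightarrow> pnorm (f x) \<le> M"
    using krasner_bounded[OF assms(1)] by blast
  \<comment> \<open>The error is split as f(g - Q) + (f - P)Q, so \<open>Q\<close> comes first and
    the tolerance for \<open>P\<close> depends on a bound for \<open>Q\<close>.\<close>
  obtain Q where Q: "\<forall>x\<in>cball a r. pnorm (g x - poly Q x) \<le> \<epsilon> / M"
    using assms(2)[THEN krasner_imp_poly_approx, of "\<epsilon> / M"] M \<epsilon> by auto
  obtain M' where M': "M' > 0" "\<And>x. x \<in> cball a r \<Longrightarrow> pnorm (poly Q x) \<le> M'"
    using krasner_bounded[OF krasner_poly[OF assms(3,4)]] by blast
  obtain P where P: "\<forall>x\<in>cball a r. pnorm (f x - poly P x) \<le> \<epsilon> / M'"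
    using assms(1)[THEN krasner_imp_poly_approx, of "\<epsilon> / M'"] M' \<epsilon> by auto
  have "pnorm (f x * g x - poly (P * Q) x) \<le> \<epsilon>" if x: "x \<in> cball a r" for x
  proof -
    have "pnorm (f x) * pnorm (g x - poly Q x) \<le> M * (\<epsilon> / M)"
      using M Q x by (intro mult_mono) auto
    moreover have "pnorm (f x - poly P x) * pnorm (poly Q x) \<le> \<epsilon> / M' * M'"
      using M' P x \<epsilon> by (intro mult_mono) auto
    ultimately have "pnorm (f x * (g x - poly Q x)) \<le> \<epsilon>" "pnorm ((f x - poly P x) * poly Q x) \<le> \<epsilon>"
      using M M' by (simp_all add: pnorm_mult)
    from pnorm_add_le[OF this] show ?thesis
      by (simp add: algebra_simps)
  qed
  then show "\<exists>P. \<forall>x\<in>cball a r. pnorm (f x * g x - poly P x) \<le> \<epsilon>"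
    by blast
qed

end

section \<open>Polynomial approximation on a union of discs\<close>

text \<open>Newton iteration for the idempotents 0 and 1 of the residue ring.\<close>

lemma idempotent_improvement:
  fixes u :: "'k::ultranormed_field"
  assumes "\<theta> \<le> 1" and "0 \<le> \<theta>"
  shows "pnorm u \<le> \<theta> \<Longrightarrow> pnorm (3 * u ^ 2 - 2 * u ^ 3) \<le> \<theta> ^ 2"
    and "pnorm (1 - u) \<le> \<theta> \<Longrightarrow> pnorm (1 - (3 * u ^ 2 - 2 * u ^ 3)) \<le> \<theta> ^ 2"
proof -
  have of_nat_le: "pnorm (of_nat n :: 'k) \<le> 1" for n
    by (induction n) (auto intro: pnorm_add_le)
  have numeral_le: "pnorm (numeral n * v :: 'k) \<le> \<theta>" if "pnorm v \<le> \<theta>" for n v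
    using of_nat_le[of "numeral n"] that assms mult_mono[of "pnorm (numeral n :: 'k)" 1 "pnorm v" \<theta>]
    by (simp add: pnorm_mult)
  have key: "pnorm (v ^ 2 * (3 - 2 * v)) \<le> \<theta> ^ 2" if v: "pnorm v \<le> \<theta>" for v :: 'k
  proof -
    have "pnorm (3 - 2 * v) \<le> 1"
      using of_nat_le[of 3] numeral_le[OF v, of "num.Bit0 num.One"] assms by (intro pnorm_diff_le) auto
    then have "pnorm v ^ 2 * pnorm (3 - 2 * v) \<le> \<theta> ^ 2 * 1"
      using v assms by (intro mult_mono power_mono) auto
    then show ?thesis
      by (simp add: pnorm_mult pnorm_power)
  qed
  show "pnorm (3 * u ^ 2 - 2 * u ^ 3) \<le> \<theta> ^ 2" if "pnorm u \<le> \<theta>"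
    using key[OF that] by (simp add: power2_eq_square power3_eq_cube algebra_simps)
  \<comment> \<open>With v = 1 - u the expression is again v^2 (3 - 2v), so \<open>key\<close>
    applies to both idempotents.\<close>
  show "pnorm (1 - (3 * u ^ 2 - 2 * u ^ 3)) \<le> \<theta> ^ 2" if "pnorm (1 - u) \<le> \<theta>"
    using key[OF that] by (simp add: power2_eq_square power3_eq_cube algebra_simps)
qed

text \<open>Some fixed error below 1 is enough for a separation to any precision, since the
  iteration squares the error.\<close>

lemma poly_separation_improve:
  fixes P :: "'k::ultranormed_field poly"
  assumes \<theta>: "0 \<le> \<theta>" "\<theta> < 1"
    and X: "\<And>x. x \<in> X \<Longrightarrow> pnorm (1 - poly P x) \<le> \<theta>"
    and Y: "\<And>y. y \<in> Y \<Longrightarrow> pnorm (poly P y) \<le> \<theta>"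
    and "\<epsilon> > 0"
  shows "\<exists>Q. (\<forall>x\<in>X. pnorm (1 - poly Q x) \<le> \<epsilon>) \<and> (\<forall>y\<in>Y. pnorm (poly Q y) \<le> \<epsilon>)"
proof -
  define F :: "'k poly \<Rightarrow> 'k poly" where "F Q = 3 * Q ^ 2 - 2 * Q ^ 3" for Q
  have F: "poly (F Q) x = 3 * poly Q x ^ 2 - 2 * poly Q x ^ 3" for Q x
    by (simp add: F_def)
  have iterate: "(\<forall>x\<in>X. pnorm (1 - poly ((F ^^ n) P) x) \<le> \<theta> ^ Suc n) \<and>
      (\<forall>y\<in>Y. pnorm (poly ((F ^^ n) P) y) \<le> \<theta> ^ Suc n)" for n
  proof (induction n)
    case (Suc n)
    \<comment> \<open>Squaring is weakened to one further factor \<theta>, which keeps the exponent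
      equal to the number of steps plus one.\<close>
    have le: "(\<theta> ^ Suc n) ^ 2 \<le> \<theta> ^ Suc (Suc n)"
      using \<theta> by (simp flip: power_mult power_Suc add: power_decreasing)
    have "\<theta> ^ Suc n \<le> 1" "0 \<le> \<theta> ^ Suc n"
      using \<theta> by (auto intro: power_le_one simp del: power_Suc)
    note improve = idempotent_improvement[OF this, THEN order_trans, OF _ le]
    show ?case
      using Suc by (auto simp: F simp del: power_Suc intro!: improve)
  qed (use X Y in auto)
  obtain n where n: "\<theta> ^ n < \<epsilon>"
    using real_arch_pow_inv[OF \<open>\<epsilon> > 0\<close> \<theta>(2)] by blast
  have "\<theta> ^ Suc n \<le> \<theta> ^ n"
    using \<theta> by (intro power_decreasing) auto
  with n iterate[of n] show ?thesis
    by (intro exI[of _ "(F ^^ n) P"]) (auto intro: order_trans less_imp_le simp del: power_Suc)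
qed

context Omega_p
begin

text \<open>The discs are added in order of their distance from \<open>b\<close>, the farthest last.
  For the new disc the polynomial is multiplied by a power of (x - a_i) / (b - a_i): near 1 on the
  disc about \<open>b\<close>, small on the new disc, and at most 1 on the earlier discs because
  they are no farther away.\<close>

lemma poly_separates_discs:
  fixes a :: "'i \<Rightarrow> 'k"
  assumes "finite I" and r: "0 < r" "r \<in> range (pnorm :: 'k \<Rightarrow> real)"
    and "\<And>i. i \<in> I \<Longrightarrow> r < dist (a i) b" and "\<epsilon> > 0"
  shows "\<exists>P. (\<forall>x\<in>cball b r. pnorm (1 - poly P x) \<le> \<epsilon>) \<and>
             (\<forall>x\<in>(\<Union>i\<in>I. cball (a i) r). pnorm (poly P x) \<le> \<epsilon>)"
  using assms(1,4,5)
proof (induction I arbitrary: \<epsilon> rule: finite_ranking_induct[where f = "\<lambda>i. dist (a i) b"])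
  case empty
  then show ?case
    by (intro exI[of _ 1]) auto
next
  case (insert i I)
  obtain \<Gamma> :: 'k where \<Gamma>: "\<Gamma> \<noteq> 0" "pnorm \<Gamma> = r"
    using r by auto
  define d where "d = dist (a i) b"
  have "r < d"
    using insert.prems by (simp add: d_def)
  with r have d: "r < d" "d > 0"
    by simp_all
  define \<theta> where "\<theta> = max (1 / 2) (r / d)"
  have \<theta>: "0 < \<theta>" "\<theta> < 1" "r / d \<le> \<theta>"
    using d by (auto simp: \<theta>_def)
  \<comment> \<open>The error \<theta> suffices here; \<open>poly_separation_improve\<close>
    restores the required precision at the end.\<close>
  obtain P where P1: "\<forall>x\<in>cball b r. pnorm (1 - poly P x) \<le> \<theta>"
    and P0: "\<forall>x\<in>(\<Union>i\<in>I. cball (a i) r). pnorm (poly P x) \<le> \<theta>"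
    using insert.IH[of \<theta>] insert.prems \<theta> by auto
  obtain C where C: "C > 0" "\<And>x. x \<in> cball (a i) r \<Longrightarrow> pnorm (poly P x) \<le> C"
    using krasner_bounded[OF krasner_poly[OF \<Gamma>]] by blast
  have "r / d < 1"
    using d by simp
  then obtain m where "(r / d) ^ m < \<theta> / C"
    using real_arch_pow_inv[of "\<theta> / C" "r / d"] \<theta> C by auto
  then have m: "C * (r / d) ^ m \<le> \<theta>"
    using C by (simp add: field_simps)
  \<comment> \<open>The linear polynomial with zero \<open>a i\<close> and value 1 at
    \<open>b\<close>. The exponent \<open>m\<close> outweighs the bound \<open>C\<close> of
    \<open>P\<close> on the new disc.\<close>
  define q where "q = smult (1 / (b - a i)) [:- a i, 1:]"
  have d_pnorm: "pnorm (b - a i) = d" "b \<noteq> a i"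
    using d by (auto simp: d_def dist_pnorm pnorm_minus_commute)
  have q: "poly q x = (x - a i) / (b - a i)" for x
    by (simp add: q_def diff_divide_distrib)
  have pnorm_q: "pnorm (poly q x) = dist x (a i) / d" for x
    using d_pnorm by (simp add: q pnorm_divide dist_pnorm)
  have q1: "pnorm (1 - poly q x) \<le> \<theta>" if "x \<in> cball b r" for x
  proof -
    have "1 - poly q x = (b - x) / (b - a i)"
      using d_pnorm by (simp add: q field_simps)
    moreover have "pnorm (b - x) / d \<le> r / d"
      using that d by (intro divide_right_mono) (auto simp: dist_pnorm)
    ultimately show ?thesis
      using \<theta> d_pnorm by (simp add: pnorm_divide)
  qed
  have q1_pow: "pnorm (1 - poly q x ^ n) \<le> \<theta> \<and> pnorm (poly q x) \<le> 1" if "x \<in> cball b r" for x n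
  proof -
    have q_le: "pnorm (poly q x) \<le> 1"
      using q1[OF that] \<theta> pnorm_diff_le[of 1 1 "1 - poly q x"] by simp
    moreover have "pnorm (1 - poly q x ^ n) \<le> \<theta>"
    proof (induction n)
      case (Suc n)
      have "pnorm (poly q x * (1 - poly q x ^ n)) \<le> 1 * \<theta>"
        unfolding pnorm_mult using q_le Suc \<theta> by (intro mult_mono) auto
      then show ?case
        using q1[OF that] pnorm_add_le[of "1 - poly q x" \<theta> "poly q x * (1 - poly q x ^ n)"]
        by (simp add: algebra_simps)
    qed (use \<theta> in simp)
    ultimately show ?thesis
      by simp
  qed
  define P' where "P' = P * q ^ m"
  have "pnorm (1 - poly P' x) \<le> \<theta>" if x: "x \<in> cball b r" for x
  proof -
    have "pnorm ((1 - poly P x) * poly q x ^ m) \<le> \<theta> * 1"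
      unfolding pnorm_mult pnorm_power using P1 q1_pow[OF x] x \<theta>
      by (intro mult_mono power_le_one) auto
    then show ?thesis
      using q1_pow[OF x, of m] pnorm_add_le[of "1 - poly q x ^ m" \<theta> "(1 - poly P x) * poly q x ^ m"]
      by (simp add: P'_def algebra_simps)
  qed
  moreover have "pnorm (poly P' x) \<le> \<theta>" if x: "x \<in> (\<Union>j\<in>insert i I. cball (a j) r)" for x
  proof (cases "x \<in> cball (a i) r")
    case True
    then have "pnorm (poly P x) * pnorm (poly q x) ^ m \<le> C * (r / d) ^ m"
      using C d by (intro mult_mono power_mono) (auto simp: pnorm_q dist_commute divide_right_mono)
    with m show ?thesis
      by (simp add: P'_def pnorm_mult pnorm_power)
  next
    case False
    then obtain j where j: "j \<in> I" "x \<in> cball (a j) r"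
      using x by auto
    have "dist x (a i) \<le> max (dist x (a j)) (dist (a j) (a i))"
      by (rule dist_ultra)
    moreover have "dist (a j) (a i) \<le> max (dist (a j) b) (dist b (a i))"
      by (rule dist_ultra)
    \<comment> \<open>Here the order of insertion enters.\<close>
    moreover have "dist (a j) b \<le> d"
      using insert.hyps j by (auto simp: d_def)
    ultimately have "dist x (a i) \<le> d"
      using j d by (auto simp: d_def dist_commute)
    then have "pnorm (poly P x) * pnorm (poly q x) ^ m \<le> \<theta> * 1"
      using P0 j d \<theta> by (intro mult_mono power_le_one) (auto simp: pnorm_q)
    then show ?thesis
      by (simp add: P'_def pnorm_mult pnorm_power)
  qed
  ultimately show ?case
    using poly_separation_improve[of \<theta> "cball b r" P' "\<Union>j\<in>insert i I. cball (a j) r" \<epsilon>] \<theta> insert.prems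
    by simp
qed

lemma disjoint_cballs_dist:
  fixes a b :: 'k
  assumes "cball a r \<inter> cball b r = {}" "0 < r"
  shows "r < dist a b"
  using assms by (metis centre_in_cball disjoint_iff less_imp_le mem_cball not_le)

text \<open>An approximation on each disc is multiplied by a polynomial that separates this disc
  from the others, and the products are summed. The separation has error \<epsilon>/M, where M
  bounds the local approximation on all discs.\<close>

lemma poly_approx_on_discs:
  fixes a :: "'i \<Rightarrow> 'k" and f :: "'k \<Rightarrow> 'k"
  assumes "finite I" and r: "0 < r" "r \<in> range (pnorm :: 'k \<Rightarrow> real)"
    and disj: "disjoint_family_on (\<lambda>i. cball (a i) r) I"
    and f: "\<And>i. i \<in> I \<Longrightarrow> krasner_analytic f (a i) r" and \<epsilon>: "\<epsilon> > 0"
  shows "\<exists>P. \<forall>x\<in>(\<Union>i\<in>I. cball (a i) r). pnorm (f x - poly P x) \<le> \<epsilon>"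
proof -
  obtain \<Gamma> :: 'k where \<Gamma>: "\<Gamma> \<noteq> 0" "pnorm \<Gamma> = r"
    using r by auto
  have bounded: "\<exists>M>0. \<forall>x\<in>(\<Union>j\<in>I. cball (a j) r). pnorm (poly P x) \<le> M" for P
  proof -
    have "\<exists>M>0. \<forall>x\<in>cball (a j) r. pnorm (poly P x) \<le> M" for j
      by (rule krasner_bounded[OF krasner_poly[OF \<Gamma>]])
    then obtain M where M: "\<And>j. M j > 0" "\<And>j x. x \<in> cball (a j) r \<Longrightarrow> pnorm (poly P x) \<le> M j"
      by metis
    have "M j \<le> 1 + (\<Sum>j\<in>I. M j)" if "j \<in> I" for j
      using member_le_sum[of j I M] that M \<open>finite I\<close> by (simp add: less_imp_le add_increasing)
    then have "\<forall>x\<in>(\<Union>j\<in>I. cball (a j) r). pnorm (poly P x) \<le> 1 + (\<Sum>j\<in>I. M j)"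
      using M(2) order_trans by fastforce
    moreover have "1 + (\<Sum>j\<in>I. M j) > 0"
      using M(1) by (simp add: add_pos_nonneg sum_nonneg less_imp_le)
    ultimately show ?thesis
      by blast
  qed
  have "\<exists>P. (\<forall>x\<in>cball (a i) r. pnorm (f x - poly P x) \<le> \<epsilon>) \<and>
            (\<forall>x\<in>(\<Union>j\<in>I - {i}. cball (a j) r). pnorm (poly P x) \<le> \<epsilon>)" if i: "i \<in> I" for i
  proof -
    obtain P where P: "\<forall>x\<in>cball (a i) r. pnorm (f x - poly P x) \<le> \<epsilon>"
      using krasner_imp_poly_approx[OF f[OF i] \<epsilon>] by blast
    obtain M where M: "M > 0" "\<forall>x\<in>(\<Union>j\<in>I. cball (a j) r). pnorm (poly P x) \<le> M"
      using bounded by blast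
    have "r < dist (a j) (a i)" if "j \<in> I - {i}" for j
      using disj i that r by (intro disjoint_cballs_dist) (auto simp: disjoint_family_on_def)
    then obtain E where E1: "\<forall>x\<in>cball (a i) r. pnorm (1 - poly E x) \<le> \<epsilon> / M"
      and E0: "\<forall>x\<in>(\<Union>j\<in>I - {i}. cball (a j) r). pnorm (poly E x) \<le> \<epsilon> / M"
      using poly_separates_discs[of "I - {i}" r a "a i" "\<epsilon> / M"] \<open>finite I\<close> r \<epsilon> M by auto
    have "pnorm (f x - poly (P * E) x) \<le> \<epsilon>" if x: "x \<in> cball (a i) r" for x
    proof -
      have "pnorm (poly P x) * pnorm (1 - poly E x) \<le> M * (\<epsilon> / M)"
        using M E1 x i by (intro mult_mono) auto
      then have "pnorm (poly P x * (1 - poly E x)) \<le> \<epsilon>"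
        using M by (simp add: pnorm_mult)
      with P x have "pnorm ((f x - poly P x) + poly P x * (1 - poly E x)) \<le> \<epsilon>"
        by (intro pnorm_add_le) auto
      then show ?thesis
        by (simp add: algebra_simps)
    qed
    moreover have "pnorm (poly (P * E) x) \<le> \<epsilon>" if x: "x \<in> (\<Union>j\<in>I - {i}. cball (a j) r)" for x
    proof -
      have "pnorm (poly P x) \<le> M" "pnorm (poly E x) \<le> \<epsilon> / M"
        using M(2) E0 x by blast+
      then have "pnorm (poly P x) * pnorm (poly E x) \<le> M * (\<epsilon> / M)"
        using M(1) by (intro mult_mono) auto
      then show ?thesis
        using M by (simp add: pnorm_mult)
    qed
    ultimately show ?thesis
      by blast
  qed
  then obtain P where P1: "\<And>i x. i \<in> I \<Longrightarrow> x \<in> cball (a i) r \<Longrightarrow> pnorm (f x - poly (P i) x) \<le> \<epsilon>"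
    and P0: "\<And>i j x. i \<in> I \<Longrightarrow> j \<in> I - {i} \<Longrightarrow> x \<in> cball (a j) r \<Longrightarrow> pnorm (poly (P i) x) \<le> \<epsilon>"
    by (metis UN_I)
  have "pnorm (f x - poly (\<Sum>i\<in>I. P i) x) \<le> \<epsilon>" if "i \<in> I" "x \<in> cball (a i) r" for i x
  proof -
    have "pnorm (\<Sum>j\<in>I - {i}. poly (P j) x) \<le> \<epsilon>"
      using \<epsilon> P0 that by (intro pnorm_sum_ultra) auto
    then show ?thesis
      using P1[OF that] pnorm_diff_le[of "f x - poly (P i) x" \<epsilon> "\<Sum>j\<in>I - {i}. poly (P j) x"]
        that \<open>finite I\<close> by (simp add: poly_sum sum.remove algebra_simps)
  qed
  then show ?thesis
    by blast
qed

end

section \<open>Disc systems\<close>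

text \<open>Only a disc that meets \<sigma> is sure to lie in \<open>nbhd\<close> and in a disc of
  any coarser cover. Discarding the others still leaves a cover of \<sigma>.\<close>

lemma relevant_discs:
  fixes a :: "nat \<Rightarrow> 'k::ultranormed_field"
  assumes cover: "\<sigma> \<subseteq> (\<Union>i\<in>{1..N}. ball (a i) r)"
    and disj: "disjoint_family_on (\<lambda>i. cball (a i) r) {1..N}"
  shows "\<exists>M b. \<sigma> \<subseteq> (\<Union>i\<in>{1..M}. ball (b i) r) \<and> disjoint_family_on (\<lambda>i. cball (b i) r) {1..M} \<and>
           b ` {1..M} \<subseteq> a ` {1..N} \<and> (\<forall>i\<in>{1..M::nat}. ball (b i) r \<inter> \<sigma> \<noteq> {})"
proof -
  define I where "I = {i\<in>{1..N}. ball (a i) r \<inter> \<sigma> \<noteq> {}}"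
  have "finite I"
    by (simp add: I_def)
  then obtain e M where e: "bij_betw e {1..M::nat} I"
    using ex_bij_betw_nat_finite_1 by blast
  define b where "b = a \<circ> e"
  have image: "e ` {1..M} = I" "inj_on e {1..M}"
    using e unfolding bij_betw_def by blast+
  have "\<sigma> \<subseteq> (\<Union>i\<in>{1..M}. ball (b i) r)"
  proof
    fix x assume x: "x \<in> \<sigma>"
    then obtain i where i: "i \<in> {1..N}" "x \<in> ball (a i) r"
      using cover by blast
    with x have "i \<in> e ` {1..M}"
      unfolding image(1) I_def by blast
    with i show "x \<in> (\<Union>i\<in>{1..M}. ball (b i) r)"
      by (auto simp: b_def)
  qed
  moreover have "disjoint_family_on (\<lambda>i. cball (b i) r) {1..M}"
    unfolding disjoint_family_on_def
  proof (intro ballI impI)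
    fix i j assume ij: "i \<in> {1..M}" "j \<in> {1..M}" "i \<noteq> j"
    then have "e i \<in> I" "e j \<in> I" and "e i \<noteq> e j"
      using image(1) inj_onD[OF image(2)] by blast+
    then have "e i \<in> {1..N}" "e j \<in> {1..N}" "e i \<noteq> e j"
      unfolding I_def by blast+
    then show "cball (b i) r \<inter> cball (b j) r = {}"
      using disj by (simp add: disjoint_family_on_def b_def)
  qed
  moreover have "e i \<in> I" if "i \<in> {1..M}" for i
    using image that by blast
  then have "b ` {1..M} \<subseteq> a ` {1..N}" "\<forall>i\<in>{1..M}. ball (b i) r \<inter> \<sigma> \<noteq> {}"
    unfolding b_def I_def by auto
  ultimately show ?thesis
    by (intro exI[of _ M] exI[of _ b] conjI)
qed

lemma cball_subset_ultra:
  fixes a b c :: "'k::ultranormed_field"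
  assumes "c \<in> cball a r" "c \<in> cball b s" "s \<le> r"
  shows "cball b s \<subseteq> cball a r"
proof
  fix x assume "x \<in> cball b s"
  then show "x \<in> cball a r"
    using assms dist_ultra[of a x c] dist_ultra[of c x b] by (simp add: dist_commute)
qed

text \<open>Every point of an ultrametric disc is a centre, in particular one that belongs to
  \<sigma>.\<close>

lemma relevant_cball_subset_nbhd:
  assumes "ball b r \<inter> \<sigma> \<noteq> {}" and "0 \<le> r"
  shows "cball b r \<subseteq> nbhd \<sigma> (r :: real)"
proof
  fix x assume x: "x \<in> cball b r"
  obtain c where c: "c \<in> \<sigma>" "c \<in> ball b r"
    using assms by blast
  then have "infdist x \<sigma> \<le> dist x c"
    by (intro infdist_le)
  also have "\<dots> \<le> r"
    using c x dist_ultra[of x c b] by (simp add: dist_commute)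
  finally show "x \<in> nbhd \<sigma> r"
    by (simp add: nbhd_def)
qed

text \<open>The distance to \<sigma> is an infimum, so a point outside the discs needs a uniform
  gap. Finitely many centres provide a minimum m > r, and moving from a centre to a point of
  \<sigma> in its disc does not bring one closer.\<close>

lemma nbhd_subset_cballs:
  fixes b :: "'i \<Rightarrow> 'k::ultranormed_field"
  assumes cover: "\<sigma> \<subseteq> (\<Union>i\<in>I. ball (b i) r)" and "finite I" "\<sigma> \<noteq> {}"
  shows "nbhd \<sigma> r \<subseteq> (\<Union>i\<in>I. cball (b i) r)"
proof
  fix x assume x: "x \<in> nbhd \<sigma> r"
  show "x \<in> (\<Union>i\<in>I. cball (b i) r)"
  proof (rule ccontr)
    assume "x \<notin> (\<Union>i\<in>I. cball (b i) r)"
    then have far: "r < dist x (b i)" if "i \<in> I" for i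
      using that by (auto simp: dist_commute)
    define m where "m = Min ((\<lambda>i. dist x (b i)) ` I)"
    have "I \<noteq> {}"
      using cover \<open>\<sigma> \<noteq> {}\<close> by auto
    then have m: "r < m" "\<And>i. i \<in> I \<Longrightarrow> m \<le> dist x (b i)"
      using far \<open>finite I\<close> by (auto simp: m_def)
    have "m \<le> dist x c" if c: "c \<in> \<sigma>" for c
    proof -
      obtain i where i: "i \<in> I" "dist (b i) c < r"
        using cover c by auto
      then show ?thesis
        using dist_ultra[of x "b i" c] far[of i] m(2)[of i] by (simp add: dist_commute)
    qed
    then have "m \<le> infdist x \<sigma>"
      using \<open>\<sigma> \<noteq> {}\<close> by (simp add: infdist_notempty cINF_greatest)
    with m x show False
      by (simp add: nbhd_def)
  qed
qed

text \<open>The smaller discs serve both functions: each one kept shares a point of \<sigma> with a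
  larger disc and is therefore contained in it.\<close>

lemma (in Omega_p) admissible_shrink:
  fixes f g :: "'k \<Rightarrow> 'k"
  assumes f: "admissible \<sigma> f N a r" and g: "admissible \<sigma> g M b s" and "s \<le> r"
  shows "\<exists>M' b'. admissible \<sigma> f M' b' s \<and> admissible \<sigma> g M' b' s"
proof -
  obtain \<Gamma> :: 'k where \<Gamma>: "\<Gamma> \<noteq> 0" "pnorm \<Gamma> = s"
    using g by (auto simp: admissible_def)
  have "\<sigma> \<subseteq> (\<Union>i\<in>{1..M}. ball (b i) s)" "disjoint_family_on (\<lambda>i. cball (b i) s) {1..M}"
    using g by (auto simp: admissible_def)
  from relevant_discs[OF this] obtain M' :: nat and b' where
    cover: "\<sigma> \<subseteq> (\<Union>i\<in>{1..M'}. ball (b' i) s)" and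
    disj: "disjoint_family_on (\<lambda>i. cball (b' i) s) {1..M'}" and
    sub: "b' ` {1..M'} \<subseteq> b ` {1..M}" and
    meets: "\<forall>i\<in>{1..M'}. ball (b' i) s \<inter> \<sigma> \<noteq> {}"
    by blast
  have "krasner_analytic g (b' i) s" if "i \<in> {1..M'}" for i
    using sub that g by (force simp: admissible_def)
  moreover have "krasner_analytic f (b' i) s" if i: "i \<in> {1..M'}" for i
  proof -
    obtain c where c: "c \<in> ball (b' i) s" "c \<in> \<sigma>"
      using meets i by blast
    then obtain j where j: "j \<in> {1..N}" "c \<in> ball (a j) r"
      using f by (auto simp: admissible_def)
    have "cball (b' i) s \<subseteq> cball (a j) r"
      using c j \<open>s \<le> r\<close> by (intro cball_subset_ultra[of c]) auto
    moreover have "krasner_analytic f (a j) r"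
      using f j by (auto simp: admissible_def)
    ultimately show ?thesis
      using \<Gamma> by (blast intro: krasner_subset[of f "a j" r])
  qed
  ultimately have "admissible \<sigma> f M' b' s \<and> admissible \<sigma> g M' b' s"
    using cover disj g by (simp add: admissible_def)
  then show ?thesis
    by blast
qed

lemma (in Omega_p) common_admissible:
  fixes f g :: "'k \<Rightarrow> 'k"
  assumes "f \<in> L_space \<sigma>" "g \<in> L_space \<sigma>"
  shows "\<exists>N a r. admissible \<sigma> f N a r \<and> admissible \<sigma> g N a r"
proof -
  obtain N a r M b s where "admissible \<sigma> f N a r" "admissible \<sigma> g M b s"
    using assms by (auto simp: L_space_def)
  then show ?thesis
    using admissible_shrink[of \<sigma> f N a r g M b s] admissible_shrink[of \<sigma> g M b s f N a r]
    by (cases "s \<le> r") auto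
qed

section \<open>The functional calculus\<close>

lemma eventually_prime_to:
  "eventually P (prime_to p) \<longleftrightarrow> (\<exists>n0. \<forall>n\<ge>n0. \<not> p dvd n \<longrightarrow> P n)"
  by (simp add: prime_to_def eventually_inf_principal eventually_sequentially)

sublocale padic_banach_algebra \<subseteq> vs: vector_space smul
  using banach_space by (simp add: padic_banach_space_def)

context padic_banach_algebra
begin

lemma pnorm_smul: "pnorm (smul c x) = pnorm c * pnorm x"
  using banach_space by (simp add: padic_banach_space_def)

lemma algebra_ultra: "pnorm (x + y :: 'a) \<le> max (pnorm x) (pnorm y)"
  using banach_space by (simp add: padic_banach_space_def)

lemma tendsto_smul: "(f \<longlongrightarrow> l) F \<Longrightarrow> ((\<lambda>n. smul c (f n)) \<longlongrightarrow> smul c l) F"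
  unfolding tendsto_pnorm_iff[of f] tendsto_pnorm_iff[of "\<lambda>n. smul c (f n)"]
  by (simp add: pnorm_smul tendsto_mult_right_zero flip: vs.scale_right_diff_distrib)

lemma tendsto_times_left:
  fixes f :: "'i \<Rightarrow> 'a"
  assumes "(f \<longlongrightarrow> l) F"
  shows "((\<lambda>n. x * f n) \<longlongrightarrow> x * l) F"
proof -
  have "((\<lambda>n. pnorm (x * f n - x * l)) \<longlongrightarrow> 0) F"
    using assms[unfolded tendsto_pnorm_iff[of f]] pnorm_mult_le[of x]
    by (elim tendsto_0_le[where K = "pnorm x"])
      (auto simp: mult.commute[of _ "pnorm x"] simp flip: right_diff_distrib intro!: always_eventually)
  then show ?thesis
    by (subst tendsto_pnorm_iff)
qed

lemma tendsto_times_right: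
  fixes f :: "'i \<Rightarrow> 'a"
  assumes "(f \<longlongrightarrow> l) F"
  shows "((\<lambda>n. f n * x) \<longlongrightarrow> l * x) F"
proof -
  have "((\<lambda>n. pnorm (f n * x - l * x)) \<longlongrightarrow> 0) F"
    using assms[unfolded tendsto_pnorm_iff[of f]] pnorm_mult_le[of _ x]
    by (elim tendsto_0_le[where K = "pnorm x"])
      (auto simp flip: left_diff_distrib intro!: always_eventually)
  then show ?thesis
    by (subst tendsto_pnorm_iff)
qed

section \<open>The resolvent identity and decay of the resolvent\<close>

lemma resolvent_right_inverse:
  assumes "z \<notin> spectrum smul A"
  shows "(smul z 1 - A) * resolvent smul z A = 1"
proof -
  obtain y where y: "(smul z 1 - A) * y = 1 \<and> y * (smul z 1 - A) = 1"
    using assms by (auto simp: spectrum_def invertible_element_def)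
  have "(smul z 1 - A) * resolvent smul z A = 1 \<and> resolvent smul z A * (smul z 1 - A) = 1"
    unfolding resolvent_def
  proof (rule theI[of _ y])
    fix y' assume "(smul z 1 - A) * y' = 1 \<and> y' * (smul z 1 - A) = 1"
    then show "y' = y"
      using y by (metis mult.assoc mult_1 mult_1_right)
  qed (rule y)
  then show ?thesis
    by blast
qed

lemma smul_resolvent:
  "z \<notin> spectrum smul A \<Longrightarrow> smul z (resolvent smul z A) = 1 + A * resolvent smul z A"
  using resolvent_right_inverse[of z A] scale_mult_left[of z 1 "resolvent smul z A"]
  by (simp add: algebra_simps)

text \<open>In zR = 1 + AR the term AR cannot dominate, because |A| < |z|. The bound is |1| since
  the norm of the unit is not normalised.\<close>

lemma pnorm_resolvent_le:
  assumes "z \<notin> spectrum smul A" and "pnorm A < pnorm z"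
  shows "pnorm z * pnorm (resolvent smul z A) \<le> pnorm (1::'a)"
proof (rule ccontr)
  let ?R = "resolvent smul z A"
  assume contra: "\<not> ?thesis"
  have "pnorm z * pnorm ?R \<le> max (pnorm (1::'a)) (pnorm (A * ?R))"
    using smul_resolvent[OF assms(1)] algebra_ultra[of 1 "A * ?R"] by (simp flip: pnorm_smul)
  then have "pnorm z * pnorm ?R \<le> pnorm A * pnorm ?R"
    using contra pnorm_mult_le[of A ?R] by linarith
  moreover have "pnorm ?R > 0"
    using contra by (metis mult_zero_right not_le pnorm_ge_0 pnorm_eq_0_iff pnorm_pos_iff)
  ultimately show False
    using assms(2) by (simp add: mult_le_cancel_right)
qed

section \<open>Linearity and boundedness of the averages\<close>

lemma average_add:
  "calculus_average smul A (\<lambda>x. f x + g x) N a \<Gamma> n =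
     calculus_average smul A f N a \<Gamma> n + calculus_average smul A g N a \<Gamma> n"
  by (simp add: calculus_average_def shnirelman_average_def distrib_right vs.scale_left_distrib
      vs.scale_right_distrib sum.distrib)

lemma average_scale:
  "calculus_average smul A (\<lambda>x. c * f x) N a \<Gamma> n = smul c (calculus_average smul A f N a \<Gamma> n)"
  by (simp add: calculus_average_def shnirelman_average_def vs.scale_sum_right mult_ac)

text \<open>The constant depends on the order \<open>n\<close> through the resolvents at finitely
  many points, but not on \<open>h\<close>.\<close>

lemma average_bound:
  "\<exists>C\<ge>0. \<forall>h M. (\<forall>i\<in>{1..N}. \<forall>x\<in>cball (a i) (pnorm \<Gamma>). pnorm (h x) \<le> M) \<longrightarrow>
      pnorm (calculus_average smul A h N a \<Gamma> n) \<le> C * M"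
proof (cases "n = 0")
  \<comment> \<open>For \<open>n = 0\<close> the factor \<open>1 / of_nat n\<close> is 0, hence the
    average vanishes.\<close>
  case True
  then show ?thesis
    by (intro exI[of _ 0]) (simp add: calculus_average_def shnirelman_average_def)
next
  case False
  define C where "C = (\<Sum>i=1..N. pnorm (1 / of_nat n :: 'k) *
      (\<Sum>\<xi> | \<xi> ^ n = 1. pnorm \<Gamma> * pnorm (resolvent smul (a i + \<xi> * \<Gamma>) A)))"
  have "C \<ge> 0"
    unfolding C_def by (intro sum_nonneg mult_nonneg_nonneg) auto
  moreover have "pnorm (calculus_average smul A h N a \<Gamma> n) \<le> C * M"
    if M: "\<forall>i\<in>{1..N}. \<forall>x\<in>cball (a i) (pnorm \<Gamma>). pnorm (h x) \<le> M" for h M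
  proof -
    let ?F = "\<lambda>i x. smul (h x * (x - a i)) (resolvent smul x A)"
    have "pnorm (calculus_average smul A h N a \<Gamma> n) \<le>
        (\<Sum>i=1..N. pnorm (shnirelman_average smul (a i) \<Gamma> (?F i) n))"
      unfolding calculus_average_def by (rule pnorm_sum_le)
    also have "\<dots> \<le> (\<Sum>i=1..N. pnorm (1 / of_nat n :: 'k) *
        (\<Sum>\<xi> | \<xi> ^ n = 1. M * (pnorm \<Gamma> * pnorm (resolvent smul (a i + \<xi> * \<Gamma>) A))))"
    proof (rule sum_mono)
      fix i assume i: "i \<in> {1..N}"
      have "pnorm (\<Sum>\<xi> | \<xi> ^ n = 1. ?F i (a i + \<xi> * \<Gamma>)) \<le>
          (\<Sum>\<xi> | \<xi> ^ n = 1. pnorm (?F i (a i + \<xi> * \<Gamma>)))"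
        by (rule pnorm_sum_le)
      also have "\<dots> \<le> (\<Sum>\<xi> | \<xi> ^ n = 1. M * (pnorm \<Gamma> * pnorm (resolvent smul (a i + \<xi> * \<Gamma>) A)))"
      proof (rule sum_mono)
        fix \<xi> :: 'k assume "\<xi> \<in> {\<xi>. \<xi> ^ n = 1}"
        then have \<xi>: "pnorm \<xi> = 1"
          using False by (auto intro: pnorm_root_of_unity)
        then have "pnorm (h (a i + \<xi> * \<Gamma>)) \<le> M"
          using M i by (simp add: dist_pnorm pnorm_mult)
        then have "pnorm (h (a i + \<xi> * \<Gamma>)) * (pnorm \<Gamma> * pnorm (resolvent smul (a i + \<xi> * \<Gamma>) A)) \<le>
            M * (pnorm \<Gamma> * pnorm (resolvent smul (a i + \<xi> * \<Gamma>) A))"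
          by (intro mult_right_mono) auto
        then show "pnorm (?F i (a i + \<xi> * \<Gamma>)) \<le> M * (pnorm \<Gamma> * pnorm (resolvent smul (a i + \<xi> * \<Gamma>) A))"
          using \<xi> by (simp add: pnorm_smul pnorm_mult mult_ac)
      qed
      finally show "pnorm (shnirelman_average smul (a i) \<Gamma> (?F i) n) \<le> pnorm (1 / of_nat n :: 'k) *
        (\<Sum>\<xi> | \<xi> ^ n = 1. M * (pnorm \<Gamma> * pnorm (resolvent smul (a i + \<xi> * \<Gamma>) A)))"
        unfolding shnirelman_average_def pnorm_smul by (intro mult_left_mono) auto
    qed
    also have "\<dots> = C * M"
      by (simp add: C_def sum_distrib_left sum_distrib_right mult_ac)
    finally show ?thesis .
  qed
  ultimately show ?thesis
    by blast
qed

text \<open>Uniqueness needs one admissible choice of discs, since otherwise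
  \<open>has_calculus_value\<close> would hold of every element; membership in
  \<open>L_space\<close> provides it.\<close>

lemma calculus_value:
  assumes "calculus_well_defined p smul A" and f: "f \<in> L_space (spectrum smul A)"
  shows "has_calculus_value p smul A f (calculus p smul A f)"
proof -
  obtain y where y: "has_calculus_value p smul A f y"
    using assms by (auto simp: calculus_well_defined_def)
  obtain N a r where adm: "admissible (spectrum smul A) f N a r"
    using f by (auto simp: L_space_def)
  then obtain \<Gamma> :: 'k where "pnorm \<Gamma> = r"
    by (auto simp: admissible_def)
  with adm have "(calculus_average smul A f N a \<Gamma> \<longlongrightarrow> y') (prime_to p)"
    if "has_calculus_value p smul A f y'" for y'
    using that by (auto simp: has_calculus_value_def)
  then show ?thesis
    unfolding calculus_def using y tendsto_unique[OF prime_to_neq_bot] by (metis theI)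
qed

text \<open>On a circle about 0 around the spectrum, x R(x) = 1 + A R(x) shows that the averages
  differ from 1 by at most |A| |1| / |\<Gamma>|. The limit is the same for all such circles, so it
  is 1.\<close>

lemma calculus_value_one:
  assumes wd: "calculus_well_defined p smul A" and bounded: "spectrum smul A \<subseteq> ball 0 B"
  shows "calculus p smul A (\<lambda>_. 1) = 1"
proof (rule ccontr)
  define y where "y = calculus p smul A (\<lambda>_. 1)"
  assume "\<not> ?thesis"
  then have y: "pnorm (y - 1) > 0"
    by (simp add: y_def)
  \<comment> \<open>The three bounds put the spectrum inside the circle, make the resolvent estimate
    applicable, and make the error |A| |1| / |\<Gamma>| smaller than |y - 1|.\<close>
  obtain \<Gamma> :: 'k where "pnorm \<Gamma> > max B (max (pnorm A) (pnorm A * pnorm (1::'a) / pnorm (y - 1)))"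
    using exists_large_scalar by blast
  then have \<Gamma>: "pnorm \<Gamma> > B" "pnorm \<Gamma> > pnorm A" "pnorm \<Gamma> * pnorm (y - 1) > pnorm A * pnorm (1::'a)"
    using y by (auto simp: field_simps)
  then have "pnorm \<Gamma> > 0"
    using le_less_trans[OF pnorm_ge_0] by blast
  then have \<Gamma>0: "\<Gamma> \<noteq> 0"
    by auto
  have "krasner_analytic (\<lambda>_. 1 :: 'k) 0 (pnorm \<Gamma>)"
    by (rule krasner_cong[OF krasner_poly[OF \<Gamma>0 refl, where P = 1]]) simp
  then have "admissible (spectrum smul A) (\<lambda>_. 1) 1 (\<lambda>_. 0) (pnorm \<Gamma>)"
    using bounded \<Gamma> \<Gamma>0 by (auto simp: admissible_def disjoint_family_on_def)
  moreover from this have "has_calculus_value p smul A (\<lambda>_. 1) y"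
    unfolding y_def by (intro calculus_value[OF wd]) (auto simp: L_space_def)
  ultimately have lim: "(calculus_average smul A (\<lambda>_. 1) 1 (\<lambda>_. 0) \<Gamma> \<longlongrightarrow> y) (prime_to p)"
    by (auto simp: has_calculus_value_def)
  have "pnorm \<Gamma> * pnorm (calculus_average smul A (\<lambda>_. 1) 1 (\<lambda>_. 0) \<Gamma> (aux_prime ^ e) - 1) \<le>
      pnorm A * pnorm (1::'a)" for e
  proof -
    define n where "n = aux_prime ^ e"
    have n: "n > 0" "pnorm (of_nat n :: 'k) = 1"
      using prime_aux_prime prime_gt_0_nat pnorm_aux_prime_power[of e] by (auto simp: n_def)
    have res: "\<xi> * \<Gamma> \<notin> spectrum smul A \<and> pnorm (\<xi> * \<Gamma>) = pnorm \<Gamma>" if "\<xi> ^ n = 1" for \<xi>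
      using bounded \<Gamma> pnorm_root_of_unity[OF that n(1)] by (auto simp: pnorm_mult dist_pnorm)
    have "calculus_average smul A (\<lambda>_. 1) 1 (\<lambda>_. 0) \<Gamma> n =
        smul (1 / of_nat n) (\<Sum>\<xi> | \<xi> ^ n = 1. 1 + A * resolvent smul (\<xi> * \<Gamma>) A)"
      by (simp add: calculus_average_def shnirelman_average_def smul_resolvent res)
    \<comment> \<open>The constant part averages to 1 only because there are exactly
      \<open>n\<close> roots of unity.\<close>
    also have "\<dots> = smul (1 / of_nat n) (of_nat n) +
        smul (1 / of_nat n) (\<Sum>\<xi> | \<xi> ^ n = 1. A * resolvent smul (\<xi> * \<Gamma>) A)"
      using card_roots_of_unity[of e] by (simp add: sum.distrib vs.scale_right_distrib n_def)
    also have "smul (1 / of_nat n) (of_nat n) = 1"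
    proof -
      have "smul (of_nat n) 1 = (of_nat n :: 'a)" for n
        by (induction n) (simp_all add: vs.scale_left_distrib)
      then have "smul (1 / of_nat n) (of_nat n) = smul (1 / of_nat n) (smul (of_nat n) 1)"
        by simp
      also have "\<dots> = 1"
        using n by simp
      finally show ?thesis .
    qed
    finally have "calculus_average smul A (\<lambda>_. 1) 1 (\<lambda>_. 0) \<Gamma> n - 1 =
        smul (1 / of_nat n) (\<Sum>\<xi> | \<xi> ^ n = 1. A * resolvent smul (\<xi> * \<Gamma>) A)"
      by simp
    then have "pnorm \<Gamma> * pnorm (calculus_average smul A (\<lambda>_. 1) 1 (\<lambda>_. 0) \<Gamma> n - 1) =
        pnorm (\<Sum>\<xi> | \<xi> ^ n = 1. smul \<Gamma> (A * resolvent smul (\<xi> * \<Gamma>) A))"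
      using n by (simp add: pnorm_smul pnorm_divide flip: vs.scale_sum_right)
    also have "\<dots> \<le> pnorm A * pnorm (1::'a)"
    proof (rule sum_ultra_le[OF algebra_ultra])
      fix \<xi> :: 'k assume "\<xi> \<in> {\<xi>. \<xi> ^ n = 1}"
      then have \<xi>: "\<xi> * \<Gamma> \<notin> spectrum smul A" "pnorm (\<xi> * \<Gamma>) = pnorm \<Gamma>"
        using res by auto
      have "pnorm (smul \<Gamma> (A * resolvent smul (\<xi> * \<Gamma>) A)) \<le>
          pnorm \<Gamma> * (pnorm A * pnorm (resolvent smul (\<xi> * \<Gamma>) A))"
        unfolding pnorm_smul by (intro mult_left_mono pnorm_mult_le) simp
      also have "\<dots> = pnorm A * (pnorm (\<xi> * \<Gamma>) * pnorm (resolvent smul (\<xi> * \<Gamma>) A))"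
        by (simp add: \<xi>)
      also have "\<dots> \<le> pnorm A * pnorm (1::'a)"
        using \<xi> \<Gamma> by (intro mult_left_mono pnorm_resolvent_le) auto
      finally show "pnorm (smul \<Gamma> (A * resolvent smul (\<xi> * \<Gamma>) A)) \<le> pnorm A * pnorm (1::'a)" .
    qed simp
    finally show ?thesis
      by (simp add: n_def)
  qed
  moreover have "(\<lambda>e. pnorm \<Gamma> * pnorm (calculus_average smul A (\<lambda>_. 1) 1 (\<lambda>_. 0) \<Gamma> (aux_prime ^ e) - 1))
      \<longlonglongrightarrow> pnorm \<Gamma> * pnorm (y - 1)"
    by (intro tendsto_intros tendsto_pnorm filterlim_compose[OF lim filterlim_aux_prime_power])
  ultimately have "pnorm \<Gamma> * pnorm (y - 1) \<le> pnorm A * pnorm (1::'a)"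
    by (intro LIMSEQ_le_const2) auto
  with \<Gamma> show False
    by linarith
qed

end

text \<open>For a polynomial the sum contains only the powers of \<xi> from 1 to the degree plus
  one, and all of them cancel at large order. The factor x - a removes the constant term, the only
  one that would survive.\<close>

lemma (in Omega_p) scalar_integral_zero:
  fixes h :: "'k \<Rightarrow> 'k" and \<Gamma> :: 'k
  assumes h: "krasner_analytic h a (pnorm \<Gamma>)" and \<Gamma>: "\<Gamma> \<noteq> 0"
  shows "(\<lambda>e. 1 / of_nat (aux_prime ^ e) *
      (\<Sum>\<xi> | \<xi> ^ (aux_prime ^ e) = 1. h (a + \<xi> * \<Gamma>) * (\<xi> * \<Gamma>))) \<longlonglongrightarrow> 0"
proof (rule metric_LIMSEQ_I)
  fix \<epsilon> :: real assume \<epsilon>: "\<epsilon> > 0"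
  \<comment> \<open>Division by |\<Gamma>| compensates the factor \<open>\<xi> * \<Gamma>\<close>;
    halving gives the strict inequality.\<close>
  obtain P where P: "\<forall>x\<in>cball a (pnorm \<Gamma>). pnorm (h x - poly P x) \<le> \<epsilon> / 2 / pnorm \<Gamma>"
    using krasner_imp_poly_approx[OF h, of "\<epsilon> / 2 / pnorm \<Gamma>"] \<epsilon> \<Gamma> by auto
  define Q where "Q = pcompose P [:a, 1:]"
  have "1 < aux_prime"
    using prime_aux_prime prime_gt_1_nat by blast
  \<comment> \<open>The 2 makes the order exceed the largest exponent \<open>degree Q + 1\<close>
    and makes \<open>e\<close> a successor.\<close>
  define e0 where "e0 = degree Q + 2"
  have "dist (1 / of_nat (aux_prime ^ e) *
      (\<Sum>\<xi> | \<xi> ^ (aux_prime ^ e) = 1. h (a + \<xi> * \<Gamma>) * (\<xi> * \<Gamma>))) 0 < \<epsilon>" if e: "e \<ge> e0" for e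
  proof -
    define n where "n = aux_prime ^ e"
    have "e < n"
      unfolding n_def using \<open>1 < aux_prime\<close> power_gt_expt[of aux_prime e] by simp
    then have n: "degree Q + 1 < n" "n > 0"
      using e by (auto simp: e0_def)
    obtain e' where e': "e = Suc e'"
      using e by (cases e) (auto simp: e0_def)
    have "(\<Sum>\<xi> | \<xi> ^ n = 1. poly P (a + \<xi> * \<Gamma>) * (\<xi> * \<Gamma>)) =
        (\<Sum>\<xi> | \<xi> ^ n = 1. \<Sum>l\<le>degree Q. coeff Q l * \<Gamma> ^ Suc l * \<xi> ^ Suc l)"
    proof (rule sum.cong)
      fix \<xi> :: 'k
      have eq: "poly P (a + \<xi> * \<Gamma>) = poly Q (\<xi> * \<Gamma>)"
        by (simp add: Q_def poly_pcompose add.commute)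
      show "poly P (a + \<xi> * \<Gamma>) * (\<xi> * \<Gamma>) = (\<Sum>l\<le>degree Q. coeff Q l * \<Gamma> ^ Suc l * \<xi> ^ Suc l)"
        unfolding eq poly_altdef[of Q] sum_distrib_right
        by (intro sum.cong refl) (simp add: power_mult_distrib mult_ac)
    qed simp
    also have "\<dots> = (\<Sum>l\<le>degree Q. coeff Q l * \<Gamma> ^ Suc l * (\<Sum>\<xi> | \<xi> ^ n = 1. \<xi> ^ Suc l))"
      by (subst sum.swap) (simp add: sum_distrib_left)
    also have "\<dots> = 0"
    proof (intro sum.neutral ballI)
      fix l assume "l \<in> {..degree Q}"
      then have "\<not> n dvd Suc l"
        using n by (auto dest!: dvd_imp_le)
      then show "coeff Q l * \<Gamma> ^ Suc l * (\<Sum>\<xi> | \<xi> ^ n = 1. \<xi> ^ Suc l) = 0"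
        using sum_roots_of_unity[of e' "Suc l"] by (simp add: n_def e' del: power_Suc)
    qed
    finally have "(\<Sum>\<xi> | \<xi> ^ n = 1. h (a + \<xi> * \<Gamma>) * (\<xi> * \<Gamma>)) =
        (\<Sum>\<xi> | \<xi> ^ n = 1. (h (a + \<xi> * \<Gamma>) - poly P (a + \<xi> * \<Gamma>)) * (\<xi> * \<Gamma>))"
      by (simp add: sum_subtractf left_diff_distrib)
    also have "pnorm \<dots> \<le> \<epsilon> / 2"
    proof (rule pnorm_sum_ultra)
      fix \<xi> :: 'k assume "\<xi> \<in> {\<xi>. \<xi> ^ n = 1}"
      then have \<xi>: "pnorm \<xi> = 1"
        using n by (auto intro: pnorm_root_of_unity)
      then have "pnorm (h (a + \<xi> * \<Gamma>) - poly P (a + \<xi> * \<Gamma>)) \<le> \<epsilon> / 2 / pnorm \<Gamma>"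
        using P by (simp add: dist_pnorm pnorm_mult)
      with \<Gamma> \<xi> show "pnorm ((h (a + \<xi> * \<Gamma>) - poly P (a + \<xi> * \<Gamma>)) * (\<xi> * \<Gamma>)) \<le> \<epsilon> / 2"
        by (simp add: pnorm_mult pos_le_divide_eq)
    qed (use \<epsilon> in simp)
    finally have "pnorm (1 / of_nat n * (\<Sum>\<xi> | \<xi> ^ n = 1. h (a + \<xi> * \<Gamma>) * (\<xi> * \<Gamma>))) \<le> \<epsilon> / 2"
      using pnorm_aux_prime_power[of e] unfolding n_def pnorm_mult pnorm_divide by simp
    then show ?thesis
      using \<epsilon> by (simp add: dist_pnorm n_def)
  qed
  then show "\<exists>e0. \<forall>e\<ge>e0. dist (1 / of_nat (aux_prime ^ e) *
      (\<Sum>\<xi> | \<xi> ^ (aux_prime ^ e) = 1. h (a + \<xi> * \<Gamma>) * (\<xi> * \<Gamma>))) 0 < \<epsilon>"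
    by blast
qed

section \<open>The calculus on one fixed system of discs\<close>

locale disc_calculus = padic_banach_algebra p smul
  for p :: nat and smul :: "'k::{ultranormed_field, complete_space} \<Rightarrow> 'a::{ring_1, pnormed} \<Rightarrow> 'a" +
  fixes A :: 'a and N :: nat and a :: "nat \<Rightarrow> 'k" and \<Gamma> :: 'k
  assumes well_defined: "calculus_well_defined p smul A"
    and \<Gamma>_nonzero: "\<Gamma> \<noteq> 0"
    and cover: "spectrum smul A \<subseteq> (\<Union>i\<in>{1..N}. ball (a i) (pnorm \<Gamma>))"
    and disjoint: "disjoint_family_on (\<lambda>i. cball (a i) (pnorm \<Gamma>)) {1..N}"
begin

definition discs :: "'k set" where
  "discs = (\<Union>i\<in>{1..N}. cball (a i) (pnorm \<Gamma>))"

definition hol :: "('k \<Rightarrow> 'k) \<Rightarrow> bool" where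
  "hol h \<longleftrightarrow> (\<forall>i\<in>{1..N}. krasner_analytic h (a i) (pnorm \<Gamma>))"

abbreviation avg :: "('k \<Rightarrow> 'k) \<Rightarrow> nat \<Rightarrow> 'a" where
  "avg h \<equiv> calculus_average smul A h N a \<Gamma>"

abbreviation \<phi> :: "('k \<Rightarrow> 'k) \<Rightarrow> 'a" where
  "\<phi> \<equiv> calculus p smul A"

lemma admissible_iff_hol: "admissible (spectrum smul A) h N a (pnorm \<Gamma>) \<longleftrightarrow> hol h"
  using \<Gamma>_nonzero cover disjoint by (auto simp: admissible_def hol_def)

lemma hol_imp_L_space: "hol h \<Longrightarrow> h \<in> L_space (spectrum smul A)"
  using admissible_iff_hol by (auto simp: L_space_def)

lemma avg_tendsto: "hol h \<Longrightarrow> (avg h \<longlongrightarrow> \<phi> h) (prime_to p)"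
  using calculus_value[OF well_defined hol_imp_L_space, of h] admissible_iff_hol[of h]
  by (auto simp: has_calculus_value_def)

lemma calculus_integral_eq: "hol h \<Longrightarrow> calculus_integral p smul A h N a \<Gamma> = \<phi> h"
  unfolding calculus_integral_def by (intro tendsto_Lim prime_to_neq_bot avg_tendsto)

lemma hol_poly: "hol (poly P)"
  unfolding hol_def using krasner_poly[OF \<Gamma>_nonzero refl] by blast

lemma hol_const: "hol (\<lambda>_. c)"
  by (rule back_subst[of hol, OF hol_poly[of "[:c:]"]]) auto

lemma hol_ident: "hol (\<lambda>x. x)"
  by (rule back_subst[of hol, OF hol_poly[of "[:0, 1:]"]]) auto

lemma hol_add: "hol f \<Longrightarrow> hol g \<Longrightarrow> hol (\<lambda>x. f x + g x)"
  unfolding hol_def using krasner_add[OF _ _ \<Gamma>_nonzero refl] by blast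

lemma hol_mult: "hol f \<Longrightarrow> hol g \<Longrightarrow> hol (\<lambda>x. f x * g x)"
  unfolding hol_def using krasner_mult[OF _ _ \<Gamma>_nonzero refl] by blast

lemma hol_scale: "hol f \<Longrightarrow> hol (\<lambda>x. c * f x)"
  by (intro hol_mult hol_const)

lemma hol_diff: "hol f \<Longrightarrow> hol g \<Longrightarrow> hol (\<lambda>x. f x - g x)"
  using hol_add[of f "\<lambda>x. - 1 * g x"] hol_scale[of g "- 1"] by simp

lemma calculus_add:
  assumes "hol f" "hol g"
  shows "\<phi> (\<lambda>x. f x + g x) = \<phi> f + \<phi> g"
proof (rule tendsto_unique[OF prime_to_neq_bot])
  show "(avg (\<lambda>x. f x + g x) \<longlongrightarrow> \<phi> (\<lambda>x. f x + g x)) (prime_to p)"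
    using assms by (intro avg_tendsto hol_add)
  show "(avg (\<lambda>x. f x + g x) \<longlongrightarrow> \<phi> f + \<phi> g) (prime_to p)"
    unfolding average_add using assms by (intro tendsto_add avg_tendsto)
qed

lemma calculus_scale:
  assumes "hol f"
  shows "\<phi> (\<lambda>x. c * f x) = smul c (\<phi> f)"
proof (rule tendsto_unique[OF prime_to_neq_bot])
  show "(avg (\<lambda>x. c * f x) \<longlongrightarrow> \<phi> (\<lambda>x. c * f x)) (prime_to p)"
    using assms by (intro avg_tendsto hol_scale)
  show "(avg (\<lambda>x. c * f x) \<longlongrightarrow> smul c (\<phi> f)) (prime_to p)"
    unfolding average_scale using assms by (intro tendsto_smul avg_tendsto)
qed

lemma calculus_diff:
  assumes "hol f" "hol g"
  shows "\<phi> (\<lambda>x. f x - g x) = \<phi> f - \<phi> g"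
  using calculus_add[OF assms(1) hol_scale[OF assms(2), of "- 1"]] calculus_scale[OF assms(2), of "- 1"]
  by simp

lemma avg_diff: "avg (\<lambda>x. f x - g x) n = avg f n - avg g n"
  using average_add[of A f "\<lambda>x. - 1 * g x" N a \<Gamma> n] average_scale[of A "- 1" g N a \<Gamma> n] by simp

lemma hol_uniform_limit:
  assumes "\<And>\<epsilon>. \<epsilon> > 0 \<Longrightarrow> \<exists>g. hol g \<and> (\<forall>x\<in>discs. pnorm (f x - g x) \<le> \<epsilon>)"
  shows "hol f"
  unfolding hol_def
proof (intro ballI krasner_uniform_limit[OF \<Gamma>_nonzero refl])
  fix i and \<epsilon> :: real assume i: "i \<in> {1..N}" and "\<epsilon> > 0"
  then obtain g where "hol g" "\<forall>x\<in>discs. pnorm (f x - g x) \<le> \<epsilon>"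
    using assms by blast
  with i show "\<exists>g. krasner_analytic g (a i) (pnorm \<Gamma>) \<and>
      (\<forall>x\<in>cball (a i) (pnorm \<Gamma>). pnorm (f x - g x) \<le> \<epsilon>)"
    unfolding hol_def discs_def by blast
qed

text \<open>The averages converge pointwise, so continuity of the limit is an instance of uniform
  boundedness.  In a gliding hump \<open>(s, m, \<delta>)\<close> the average of \<open>s\<close> of order \<open>m\<close> is large, and later
  corrections, which are bounded by \<open>\<delta>\<close>, change it by at most 1.\<close>

definition hump :: "nat \<Rightarrow> ('k \<Rightarrow> 'k) \<times> nat \<times> real \<Rightarrow> bool" where
  "hump j = (\<lambda>(s, m, \<delta>). hol s \<and> 0 < \<delta> \<and> \<delta> \<le> 1 / real (Suc j) \<and> j \<le> m \<and> \<not> p dvd m \<and>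
     real j + 1 < pnorm (avg s m) \<and> (\<forall>h. (\<forall>x\<in>discs. pnorm (h x) \<le> \<delta>) \<longrightarrow> pnorm (avg h m) \<le> 1))"

text \<open>A correction \<open>h\<close> that is small on the discs may have a value exceeding that
  of \<open>s\<close> by any amount. The sum then has a large value, hence a large average of some
  late order \<open>m\<close>; the bound for this single average determines \<delta>'.\<close>

lemma next_hump:
  assumes large: "\<And>\<delta> K. \<delta> > 0 \<Longrightarrow> \<exists>h. hol h \<and> (\<forall>x\<in>discs. pnorm (h x) \<le> \<delta>) \<and> K < pnorm (\<phi> h)"
    and s: "hol s" and "\<delta> > 0"
  shows "\<exists>s' m \<delta>'. hump j (s', m, \<delta>') \<and> (\<forall>x\<in>discs. pnorm (s' x - s x) \<le> \<delta>) \<and> \<delta>' \<le> \<delta>"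
proof -
  obtain h where h: "hol h" "\<forall>x\<in>discs. pnorm (h x) \<le> \<delta>" "real j + 1 + pnorm (\<phi> s) < pnorm (\<phi> h)"
    using large[OF \<open>\<delta> > 0\<close>] by blast
  define s' where "s' x = s x + h x" for x
  have s': "hol s'"
    unfolding s'_def using s h by (intro hol_add)
  have "\<phi> s' = \<phi> s + \<phi> h"
    unfolding s'_def using s h by (intro calculus_add)
  then have "pnorm (\<phi> h) \<le> pnorm (\<phi> s') + pnorm (\<phi> s)"
    using pnorm_triangle[of "\<phi> s'" "- \<phi> s"] by simp
  with h have "real j + 1 < pnorm (\<phi> s')"
    by linarith
  then have "\<forall>\<^sub>F m in prime_to p. real j + 1 < pnorm (avg s' m)"
    by (intro order_tendstoD(1)[OF tendsto_pnorm[OF avg_tendsto[OF s']]])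
  moreover have "\<forall>\<^sub>F m in prime_to p. j \<le> m \<and> \<not> p dvd m"
    by (auto simp: eventually_prime_to)
  ultimately obtain m where m: "j \<le> m" "\<not> p dvd m" "real j + 1 < pnorm (avg s' m)"
    using eventually_happens'[OF prime_to_neq_bot eventually_conj] by blast
  obtain C where C: "C \<ge> 0" "\<And>h M. (\<forall>x\<in>discs. pnorm (h x) \<le> M) \<Longrightarrow> pnorm (avg h m) \<le> C * M"
    using average_bound[of N a \<Gamma> A m] unfolding discs_def by blast
  \<comment> \<open>The quotient with C + 1 yields C \<delta>' \<le> 1 even when \<open>C\<close> is
    0.\<close>
  define \<delta>' where "\<delta>' = min \<delta> (min (1 / real (Suc j)) (1 / (C + 1)))"
  have "C * \<delta>' \<le> C * (1 / (C + 1))"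
    using C by (intro mult_left_mono) (auto simp: \<delta>'_def)
  also have "\<dots> \<le> 1"
    using C by simp
  finally have "hump j (s', m, \<delta>')"
    unfolding hump_def using s' m C \<open>\<delta> > 0\<close> by (fastforce simp: \<delta>'_def)
  moreover have "\<forall>x\<in>discs. pnorm (s' x - s x) \<le> \<delta>" "\<delta>' \<le> \<delta>"
    using h by (auto simp: s'_def \<delta>'_def)
  ultimately show ?thesis
    by blast
qed

lemma calculus_continuous:
  assumes "\<epsilon> > 0"
  shows "\<exists>\<delta>>0. \<forall>h. hol h \<longrightarrow> (\<forall>x\<in>discs. pnorm (h x) \<le> \<delta>) \<longrightarrow> pnorm (\<phi> h) < \<epsilon>"
proof (rule ccontr)
  assume contra: "\<not> ?thesis"
  \<comment> \<open>Scaling turns values bounded away from 0 on ever smaller functions into values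
    as large as desired.\<close>
  have large: "\<exists>h. hol h \<and> (\<forall>x\<in>discs. pnorm (h x) \<le> \<delta>) \<and> K < pnorm (\<phi> h)" if "\<delta> > 0" for \<delta> K
  proof -
    obtain c :: 'k where "max 1 (K / \<epsilon>) < pnorm c"
      using exists_large_scalar by blast
    then have c: "pnorm c > 0" "K < pnorm c * \<epsilon>"
      using \<open>\<epsilon> > 0\<close> by (auto simp: field_simps)
    have "\<delta> / pnorm c > 0"
      using c that by simp
    then obtain h where h: "hol h" "\<forall>x\<in>discs. pnorm (h x) \<le> \<delta> / pnorm c" "\<not> pnorm (\<phi> h) < \<epsilon>"
      using contra by blast
    have "pnorm c * \<epsilon> \<le> pnorm (\<phi> (\<lambda>x. c * h x))"
      using h c by (simp add: calculus_scale pnorm_smul)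
    then show ?thesis
      using h c by (intro exI[of _ "\<lambda>x. c * h x"]) (auto simp: hol_scale pnorm_mult field_simps)
  qed
  define Q where "Q = (\<lambda>(s, m::nat, \<delta>) (s', m'::nat, \<delta>'::real). (\<forall>x\<in>discs. pnorm (s' x - s x :: 'k) \<le> \<delta>) \<and> \<delta>' \<le> \<delta>)"
  have hump_ex: "\<exists>s' m \<delta>'. hump j (s', m, \<delta>') \<and> (\<forall>x\<in>discs. pnorm (s' x - s x) \<le> \<delta>) \<and> \<delta>' \<le> \<delta>"
    if "hol s" "\<delta> > 0" for j s \<delta>
    by (rule next_hump[OF _ that]) (rule large)
  have "\<exists>X. \<forall>j. hump j (X j) \<and> Q (X j) (X (Suc j))"
  proof (rule dependent_nat_choice)
    show "\<exists>X. hump 0 X"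
      using hump_ex[OF hol_const, of 1 0 0] by auto
    fix X j assume "hump j X"
    then obtain s m \<delta> where X: "X = (s, m, \<delta>)" "hol s" "\<delta> > 0"
      by (cases X) (auto simp: hump_def)
    show "\<exists>Y. hump (Suc j) Y \<and> Q X Y"
      using hump_ex[OF X(2,3), of "Suc j"] by (auto simp: X(1) Q_def)
  qed
  then obtain X where X: "\<And>j. hump j (X j)" "\<And>j. Q (X j) (X (Suc j))"
    by blast
  define s m \<delta> where "s j = fst (X j)" and "m j = fst (snd (X j))" and "\<delta> j = snd (snd (X j))" for j
  have X_eq: "X j = (s j, m j, \<delta> j)" for j
    by (simp add: s_def m_def \<delta>_def)
  have s: "hol (s j)" and \<delta>: "0 < \<delta> j" "\<delta> j \<le> 1 / real (Suc j)" and m: "j \<le> m j" "\<not> p dvd m j"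
    and big: "real j + 1 < pnorm (avg (s j) (m j))"
    and small: "(\<forall>x\<in>discs. pnorm (h x) \<le> \<delta> j) \<Longrightarrow> pnorm (avg h (m j)) \<le> 1" for j h
    using X(1)[of j] by (auto simp: hump_def X_eq)
  have succ: "x \<in> discs \<Longrightarrow> pnorm (s (Suc j) x - s j x) \<le> \<delta> j" "\<delta> (Suc j) \<le> \<delta> j" for j x
    using X(2)[of j] by (auto simp: Q_def X_eq)
  have \<delta>_mono: "\<delta> i \<le> \<delta> j" if "j \<le> i" for i j
    using succ(2) that by (rule lift_Suc_antimono_le)
  have s_diff: "pnorm (s i x - s j x) \<le> \<delta> j" if "x \<in> discs" "j \<le> i" for x i j
    using that(2)
  proof (induction i rule: dec_induct)
    case base
    then show ?case
      using \<delta>(1)[of j] by simp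
  next
    case (step i)
    have "pnorm (s (Suc i) x - s i x) \<le> \<delta> j"
      using succ(1)[OF that(1), of i] \<delta>_mono[OF step.hyps(1)] by simp
    then show ?case
      using step.IH by (rule pnorm_triangle_ultra)
  qed
  have \<delta>_ex: "\<exists>j. \<delta> j < \<eta>" if \<eta>: "\<eta> > 0" for \<eta>
  proof -
    obtain j where "inverse (real (Suc j)) < \<eta>"
      using reals_Archimedean[OF \<eta>] by blast
    then show ?thesis
      using \<delta>(2)[of j] by (intro exI[of _ j]) (simp add: inverse_eq_divide)
  qed
  define f where "f x = lim (\<lambda>i. s i x)" for x
  have lim_f: "(\<lambda>i. s i x) \<longlonglongrightarrow> f x" if x: "x \<in> discs" for x
  proof -
    have "Cauchy (\<lambda>i. s i x)"
    proof (rule metric_CauchyI)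
      fix \<eta> :: real assume "\<eta> > 0"
      then obtain j where j: "\<delta> j < \<eta>"
        using \<delta>_ex by blast
      have "dist (s i x) (s k x) < \<eta>" if "j \<le> i" "j \<le> k" for i k
        using s_diff[OF x that(1)] s_diff[OF x that(2)] j pnorm_diff_le[of "s i x - s j x" "\<delta> j" "s k x - s j x"]
        by (simp add: dist_pnorm)
      then show "\<exists>M. \<forall>i\<ge>M. \<forall>k\<ge>M. dist (s i x) (s k x) < \<eta>"
        by blast
    qed
    then show ?thesis
      by (simp add: f_def Cauchy_convergent_iff convergent_LIMSEQ_iff)
  qed
  have f_diff: "pnorm (f x - s j x) \<le> \<delta> j" if x: "x \<in> discs" for x j
  proof (rule tendsto_upperbound)
    show "(\<lambda>i. pnorm (s i x - s j x)) \<longlonglongrightarrow> pnorm (f x - s j x)"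
      by (intro tendsto_pnorm tendsto_intros lim_f x)
    show "\<forall>\<^sub>F i in sequentially. pnorm (s i x - s j x) \<le> \<delta> j"
      using s_diff[OF x] by (auto simp: eventually_sequentially)
  qed simp
  \<comment> \<open>The contradiction needs convergence of the averages of \<open>f\<close>, hence
    analyticity of the limit.\<close>
  have f: "hol f"
  proof (rule hol_uniform_limit)
    fix \<eta> :: real assume "\<eta> > 0"
    then obtain j where "\<delta> j < \<eta>"
      using \<delta>_ex by blast
    then show "\<exists>g. hol g \<and> (\<forall>x\<in>discs. pnorm (f x - g x) \<le> \<eta>)"
      using s order_trans[OF f_diff less_imp_le] by (intro exI[of _ "s j"]) auto
  qed
  have "\<forall>\<^sub>F n in prime_to p. pnorm (avg f n) < pnorm (\<phi> f) + 1"
    by (intro order_tendstoD(2)[OF tendsto_pnorm[OF avg_tendsto[OF f]]]) simp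
  then obtain n0 where n0: "\<And>n. n \<ge> n0 \<Longrightarrow> \<not> p dvd n \<Longrightarrow> pnorm (avg f n) < pnorm (\<phi> f) + 1"
    by (auto simp: eventually_prime_to)
  \<comment> \<open>As \<open>m j\<close> is at least \<open>j\<close>, the average of
    \<open>f\<close> of order \<open>m j\<close> is already below |\<phi> f| + 1 \<le> j, whereas
    the hump pushes it above j.\<close>
  obtain j :: nat where j: "max (real n0) (pnorm (\<phi> f) + 1) \<le> real j"
    using real_arch_simple by blast
  have "pnorm (avg f (m j)) < pnorm (\<phi> f) + 1"
    using j m[of j] by (intro n0) auto
  moreover have "pnorm (avg (s j) (m j)) \<le> pnorm (avg f (m j)) + 1"
    using small[where j = j and h = "\<lambda>x. f x - s j x"] f_diff
      pnorm_triangle[of "avg f (m j)" "avg (s j) (m j) - avg f (m j)"]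
    by (simp add: avg_diff pnorm_minus_commute[of "avg f _"])
  ultimately show False
    using big[of j] j by linarith
qed

lemma calculus_uniform_limit:
  assumes "\<And>j. hol (s j)" "hol f"
    and unif: "\<And>\<epsilon>. \<epsilon> > 0 \<Longrightarrow> \<forall>\<^sub>F j in F. \<forall>x\<in>discs. pnorm (s j x - f x) \<le> \<epsilon>"
  shows "((\<lambda>j. \<phi> (s j)) \<longlongrightarrow> \<phi> f) F"
proof (rule tendstoI)
  fix \<epsilon> :: real assume "\<epsilon> > 0"
  then obtain \<delta> where "\<delta> > 0" and \<delta>: "\<And>h. hol h \<Longrightarrow> \<forall>x\<in>discs. pnorm (h x) \<le> \<delta> \<Longrightarrow> pnorm (\<phi> h) < \<epsilon>"
    using calculus_continuous by blast
  from unif[OF \<open>\<delta> > 0\<close>] show "\<forall>\<^sub>F j in F. dist (\<phi> (s j)) (\<phi> f) < \<epsilon>"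
  proof eventually_elim
    case (elim j)
    then show ?case
      using \<delta>[of "\<lambda>x. s j x - f x"] assms by (simp add: dist_pnorm calculus_diff hol_diff)
  qed
qed

section \<open>Multiplicativity of the calculus\<close>

lemma circle_not_in_spectrum:
  assumes "i \<in> {1..N}" "pnorm \<xi> = 1"
  shows "a i + \<xi> * \<Gamma> \<notin> spectrum smul A"
proof
  define x where "x = a i + \<xi> * \<Gamma>"
  have x: "dist (a i) x = pnorm \<Gamma>"
    using assms(2) by (simp add: x_def dist_pnorm pnorm_mult)
  assume "a i + \<xi> * \<Gamma> \<in> spectrum smul A"
  then obtain j where j: "j \<in> {1..N}" "x \<in> ball (a j) (pnorm \<Gamma>)"
    using cover unfolding x_def by blast
  \<comment> \<open>Open discs in the cover rule out the disc bounded by this circle; disjointness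
    of the closed discs rules out all others.\<close>
  with x have "j \<noteq> i"
    by auto
  with disjoint assms(1) j(1) have "cball (a i) (pnorm \<Gamma>) \<inter> cball (a j) (pnorm \<Gamma>) = {}"
    by (auto simp: disjoint_family_on_def)
  moreover have "x \<in> cball (a i) (pnorm \<Gamma>)" "x \<in> cball (a j) (pnorm \<Gamma>)"
    using x j(2) by simp_all
  ultimately show False
    by blast
qed

text \<open>An exact identity at every order; the scalar summand is what
  \<open>scalar_integral_zero\<close> sends to 0.\<close>

lemma avg_ident_mult:
  assumes "n > 0"
  shows "avg (\<lambda>x. x * h x) n = A * avg h n +
    smul (\<Sum>i=1..N. 1 / of_nat n * (\<Sum>\<xi> | \<xi> ^ n = 1. h (a i + \<xi> * \<Gamma>) * (\<xi> * \<Gamma>))) 1"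
proof -
  let ?x = "\<lambda>i \<xi>. a i + \<xi> * \<Gamma>"
  have "avg (\<lambda>x. x * h x) n = (\<Sum>i=1..N. smul (1 / of_nat n) (\<Sum>\<xi> | \<xi> ^ n = 1.
      smul (h (?x i \<xi>) * (\<xi> * \<Gamma>)) (1 + A * resolvent smul (?x i \<xi>) A)))"
    unfolding calculus_average_def shnirelman_average_def
  proof (intro sum.cong refl arg_cong[of _ _ "smul _"])
    fix i and \<xi> :: 'k assume "i \<in> {1..N}" "\<xi> \<in> {\<xi>. \<xi> ^ n = 1}"
    then have "?x i \<xi> \<notin> spectrum smul A"
      using assms by (intro circle_not_in_spectrum) (auto intro: pnorm_root_of_unity)
    note resolvent = smul_resolvent[OF this]
    have "smul (?x i \<xi> * h (?x i \<xi>) * (?x i \<xi> - a i)) (resolvent smul (?x i \<xi>) A) =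
        smul (h (?x i \<xi>) * (\<xi> * \<Gamma>)) (smul (?x i \<xi>) (resolvent smul (?x i \<xi>) A))"
      by (simp only: vs.scale_scale add_diff_cancel_left' mult_ac)
    then show "smul (?x i \<xi> * h (?x i \<xi>) * (?x i \<xi> - a i)) (resolvent smul (?x i \<xi>) A) =
        smul (h (?x i \<xi>) * (\<xi> * \<Gamma>)) (1 + A * resolvent smul (?x i \<xi>) A)"
      by (simp only: resolvent)
  qed
  also have "\<dots> = (\<Sum>i=1..N. smul (1 / of_nat n) (\<Sum>\<xi> | \<xi> ^ n = 1. smul (h (?x i \<xi>) * (\<xi> * \<Gamma>)) 1)) +
      (\<Sum>i=1..N. smul (1 / of_nat n) (\<Sum>\<xi> | \<xi> ^ n = 1.
        smul (h (?x i \<xi>) * (\<xi> * \<Gamma>)) (A * resolvent smul (?x i \<xi>) A)))"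
    by (simp add: vs.scale_right_distrib sum.distrib)
  also have "(\<Sum>i=1..N. smul (1 / of_nat n) (\<Sum>\<xi> | \<xi> ^ n = 1.
      smul (h (?x i \<xi>) * (\<xi> * \<Gamma>)) (A * resolvent smul (?x i \<xi>) A))) = A * avg h n"
    by (simp add: calculus_average_def shnirelman_average_def sum_distrib_left flip: scale_mult_right)
  also have "(\<Sum>i=1..N. smul (1 / of_nat n) (\<Sum>\<xi> | \<xi> ^ n = 1. smul (h (?x i \<xi>) * (\<xi> * \<Gamma>)) 1)) =
      smul (\<Sum>i=1..N. 1 / of_nat n * (\<Sum>\<xi> | \<xi> ^ n = 1. h (?x i \<xi>) * (\<xi> * \<Gamma>))) 1"
    by (simp add: vs.scale_sum_left vs.scale_sum_right sum_distrib_left)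
  finally show ?thesis
    by (simp add: add.commute)
qed

lemma calculus_ident_mult:
  assumes h: "hol h"
  shows "\<phi> (\<lambda>x. x * h x) = A * \<phi> h"
proof -
  define c where "c n = (\<Sum>i=1..N. 1 / of_nat n * (\<Sum>\<xi> | \<xi> ^ n = 1. h (a i + \<xi> * \<Gamma>) * (\<xi> * \<Gamma>)))" for n :: nat
  have "(\<lambda>e. c (aux_prime ^ e)) \<longlonglongrightarrow> (\<Sum>i=1..N. 0)"
    unfolding c_def using h \<Gamma>_nonzero
    by (intro tendsto_sum scalar_integral_zero) (auto simp: hol_def)
  then have "(\<lambda>e. pnorm (c (aux_prime ^ e)) * pnorm (1::'a)) \<longlonglongrightarrow> 0"
    by (intro tendsto_mult_left_zero) (simp add: tendsto_pnorm_iff)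
  then have "(\<lambda>e. smul (c (aux_prime ^ e)) 1) \<longlonglongrightarrow> 0"
    by (simp add: tendsto_pnorm_iff[of _ 0] pnorm_smul)
  moreover have "(\<lambda>e. A * avg h (aux_prime ^ e)) \<longlonglongrightarrow> A * \<phi> h"
    by (intro tendsto_times_left filterlim_compose[OF avg_tendsto[OF h] filterlim_aux_prime_power])
  ultimately have "(\<lambda>e. A * avg h (aux_prime ^ e) + smul (c (aux_prime ^ e)) 1) \<longlonglongrightarrow> A * \<phi> h + 0"
    by (intro tendsto_add)
  moreover have "A * avg h (aux_prime ^ e) + smul (c (aux_prime ^ e)) 1 = avg (\<lambda>x. x * h x) (aux_prime ^ e)" for e
    unfolding c_def using prime_aux_prime prime_gt_0_nat by (intro avg_ident_mult[symmetric]) simp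
  ultimately have "(\<lambda>e. avg (\<lambda>x. x * h x) (aux_prime ^ e)) \<longlonglongrightarrow> A * \<phi> h"
    by simp
  moreover have "(\<lambda>e. avg (\<lambda>x. x * h x) (aux_prime ^ e)) \<longlonglongrightarrow> \<phi> (\<lambda>x. x * h x)"
    using h by (intro filterlim_compose[OF avg_tendsto filterlim_aux_prime_power] hol_mult hol_ident)
  ultimately show ?thesis
    by (rule LIMSEQ_unique[symmetric])
qed

lemma calculus_one: "\<phi> (\<lambda>_. 1) = 1"
proof -
  define B where "B = (\<Sum>i=1..N. pnorm (a i)) + pnorm \<Gamma>"
  have "ball (a i) (pnorm \<Gamma>) \<subseteq> ball 0 B" if "i \<in> {1..N}" for i
  proof
    fix x assume "x \<in> ball (a i) (pnorm \<Gamma>)"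
    moreover have "pnorm (a i) \<le> (\<Sum>i=1..N. pnorm (a i))"
      using that by (intro member_le_sum) auto
    ultimately show "x \<in> ball 0 B"
      using dist_triangle[of 0 x "a i"] by (simp add: B_def dist_pnorm)
  qed
  then have "spectrum smul A \<subseteq> ball 0 B"
    using cover by blast
  then show ?thesis
    by (rule calculus_value_one[OF well_defined])
qed

text \<open>Horner's scheme: each step uses \<open>calculus_ident_mult\<close> once for P h and once
  for P. Writing \<open>\<phi> (poly P)\<close> avoids evaluating polynomials in the
  algebra.\<close>

lemma calculus_poly_mult:
  assumes h: "hol h"
  shows "\<phi> (\<lambda>x. poly P x * h x) = \<phi> (poly P) * \<phi> h"
proof (induction P)
  case 0
  have "\<phi> (\<lambda>_. 0) = 0"
    using calculus_scale[OF hol_const, of 0 0] by simp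
  moreover have "poly 0 = (\<lambda>_. 0 :: 'k)"
    by (rule ext) simp
  ultimately show ?case
    by simp
next
  case (pCons c P)
  have "\<phi> (\<lambda>x. poly (pCons c P) x * h x) = \<phi> (\<lambda>x. c * h x + x * (poly P x * h x))"
    by (simp add: algebra_simps)
  also have "\<dots> = smul c (\<phi> h) + A * \<phi> (\<lambda>x. poly P x * h x)"
    using h by (simp add: calculus_add calculus_scale calculus_ident_mult hol_scale hol_mult hol_ident hol_poly)
  also have "\<dots> = (smul c 1 + A * \<phi> (poly P)) * \<phi> h"
    by (simp add: pCons.IH distrib_right mult.assoc flip: scale_mult_left)
  also have "smul c 1 + A * \<phi> (poly P) = \<phi> (\<lambda>x. c * 1 + x * poly P x)"
    using calculus_add[OF hol_scale[OF hol_const[of 1], of c] hol_mult[OF hol_ident hol_poly[of P]]]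
      calculus_scale[OF hol_const[of 1], of c] calculus_ident_mult[OF hol_poly[of P]] calculus_one
    by simp
  also have "(\<lambda>x. c * 1 + x * poly P x) = poly (pCons c P)"
    by (simp add: fun_eq_iff)
  finally show ?case .
qed

lemma hol_bounded:
  assumes "hol h"
  shows "\<exists>M>0. \<forall>x\<in>discs. pnorm (h x) \<le> M"
proof -
  have "\<forall>i\<in>{1..N}. \<exists>M>0. \<forall>x\<in>cball (a i) (pnorm \<Gamma>). pnorm (h x) \<le> M"
    using assms krasner_bounded by (auto simp: hol_def)
  then obtain M where M: "\<And>i. i \<in> {1..N} \<Longrightarrow> 0 < M i"
      "\<And>i x. i \<in> {1..N} \<Longrightarrow> x \<in> cball (a i) (pnorm \<Gamma>) \<Longrightarrow> pnorm (h x) \<le> M i"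
    by metis
  have "pnorm (h x) \<le> 1 + (\<Sum>i=1..N. M i)" if "x \<in> discs" for x
  proof -
    obtain i where i: "i \<in> {1..N}" "x \<in> cball (a i) (pnorm \<Gamma>)"
      using \<open>x \<in> discs\<close> by (auto simp: discs_def)
    moreover have "M i \<le> (\<Sum>i=1..N. M i)"
      using i M(1) by (intro member_le_sum) (auto intro: less_imp_le)
    ultimately show ?thesis
      using M(2)[of i x] by linarith
  qed
  moreover have "1 + (\<Sum>i=1..N. M i) > 0"
    using M(1) by (intro add_pos_nonneg sum_nonneg) (auto intro: less_imp_le)
  ultimately show ?thesis
    by blast
qed

lemma hol_poly_approx:
  assumes "hol f" "\<epsilon> > 0"
  shows "\<exists>P. \<forall>x\<in>discs. pnorm (f x - poly P x) \<le> \<epsilon>"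
  unfolding discs_def using assms \<Gamma>_nonzero disjoint
  by (intro poly_approx_on_discs) (auto simp: hol_def)

lemma calculus_mult:
  assumes f: "hol f" and g: "hol g"
  shows "\<phi> (\<lambda>x. f x * g x) = \<phi> f * \<phi> g"
proof -
  obtain M where M: "M > 0" "\<forall>x\<in>discs. pnorm (g x) \<le> M"
    using hol_bounded[OF g] by blast
  have "\<exists>P. \<forall>x\<in>discs. pnorm (f x - poly P x) \<le> inverse (real (Suc j))" for j
    by (intro hol_poly_approx f) simp
  then obtain P where P: "\<And>j x. x \<in> discs \<Longrightarrow> pnorm (f x - poly (P j) x) \<le> inverse (real (Suc j))"
    by metis
  have approx: "\<forall>\<^sub>F j in sequentially. \<forall>x\<in>discs. pnorm (poly (P j) x - f x) \<le> \<epsilon>" if "\<epsilon> > 0" for \<epsilon>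
  proof -
    have "\<forall>\<^sub>F j in sequentially. inverse (real (Suc j)) < \<epsilon>"
      using order_tendstoD(2)[OF LIMSEQ_inverse_real_of_nat that] .
    then show ?thesis
    proof eventually_elim
      case (elim j)
      then show ?case
        using P[of _ j] by (auto simp: pnorm_minus_commute[of "f _"] intro: order_trans less_imp_le)
    qed
  qed
  have "(\<lambda>j. \<phi> (\<lambda>x. poly (P j) x * g x)) \<longlonglongrightarrow> \<phi> (\<lambda>x. f x * g x)"
  proof (rule calculus_uniform_limit)
    fix \<epsilon> :: real assume "\<epsilon> > 0"
    then have "\<epsilon> / M > 0"
      using M by simp
    from approx[OF this]
    show "\<forall>\<^sub>F j in sequentially. \<forall>x\<in>discs. pnorm (poly (P j) x * g x - f x * g x) \<le> \<epsilon>"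
    proof eventually_elim
      case (elim j)
      show ?case
      proof
        fix x assume "x \<in> discs"
        then have "pnorm (poly (P j) x - f x) * pnorm (g x) \<le> \<epsilon> / M * M"
          using elim M \<open>\<epsilon> > 0\<close> by (intro mult_mono) auto
        then show "pnorm (poly (P j) x * g x - f x * g x) \<le> \<epsilon>"
          using M by (simp flip: pnorm_mult left_diff_distrib)
      qed
    qed
  qed (intro hol_mult hol_poly f g)+
  moreover have "(\<lambda>j. \<phi> (poly (P j)) * \<phi> g) \<longlonglongrightarrow> \<phi> f * \<phi> g"
    using approx by (intro tendsto_times_right calculus_uniform_limit hol_poly f)
  ultimately show ?thesis
    using g by (simp add: calculus_poly_mult LIMSEQ_unique)
qed

text \<open>When all discs meet the spectrum, their union is squeezed onto \<open>nbhd\<close>: one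
  inclusion makes members of \<open>B_space\<close> analytic on the discs, the other makes the
  supremum in \<open>B_norm\<close> one over a bounded set.\<close>

lemma B_space_continuous:
  assumes meets: "\<forall>i\<in>{1..N}. ball (a i) (pnorm \<Gamma>) \<inter> spectrum smul A \<noteq> {}"
    and h: "h \<in> B_space (pnorm \<Gamma>) (spectrum smul A)" and "\<epsilon> > 0"
  shows "\<exists>\<delta>>0. \<forall>h'\<in>B_space (pnorm \<Gamma>) (spectrum smul A).
      B_norm (pnorm \<Gamma>) (spectrum smul A) (\<lambda>x. h' x - h x) < \<delta> \<longrightarrow> pnorm (\<phi> h' - \<phi> h) < \<epsilon>"
proof -
  let ?\<sigma> = "spectrum smul A"
  have sub: "cball (a i) (pnorm \<Gamma>) \<subseteq> nbhd ?\<sigma> (pnorm \<Gamma>)" if "i \<in> {1..N}" for i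
    using meets that by (intro relevant_cball_subset_nbhd) auto
  have hol: "hol g" if "g \<in> B_space (pnorm \<Gamma>) ?\<sigma>" for g
    using sub that by (auto simp: B_space_def hol_def)
  obtain \<delta> where "\<delta> > 0" and \<delta>: "\<And>h. hol h \<Longrightarrow> \<forall>x\<in>discs. pnorm (h x) \<le> \<delta> \<Longrightarrow> pnorm (\<phi> h) < \<epsilon>"
    using calculus_continuous[OF \<open>\<epsilon> > 0\<close>] by blast
  have "pnorm (\<phi> h' - \<phi> h) < \<epsilon>" if h': "h' \<in> B_space (pnorm \<Gamma>) ?\<sigma>"
    and small: "B_norm (pnorm \<Gamma>) ?\<sigma> (\<lambda>x. h' x - h x) < \<delta>" for h'
  proof -
    have d: "hol (\<lambda>x. h' x - h x)"
      using hol h h' by (intro hol_diff)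
    have "pnorm (h' x - h x) \<le> \<delta>" if x: "x \<in> discs" for x
    proof -
      \<comment> \<open>For an empty spectrum \<open>infdist\<close> is 0 and \<open>nbhd\<close> is
        the whole field.\<close>
      have "?\<sigma> \<noteq> {}"
        using x meets by (auto simp: discs_def)
      then have "nbhd ?\<sigma> (pnorm \<Gamma>) \<subseteq> discs"
        unfolding discs_def using cover by (intro nbhd_subset_cballs) auto
      moreover obtain M where "\<forall>x\<in>discs. pnorm (h' x - h x) \<le> M"
        using hol_bounded[OF d] by blast
      \<comment> \<open>Without boundedness the real supremum would not dominate the values.\<close>
      ultimately have "bdd_above ((\<lambda>x. pnorm (h' x - h x)) ` nbhd ?\<sigma> (pnorm \<Gamma>))"
        by (intro bdd_aboveI2[of _ _ M]) blast
      moreover have "x \<in> nbhd ?\<sigma> (pnorm \<Gamma>)"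
        using x sub unfolding discs_def by blast
      ultimately have "pnorm (h' x - h x) \<le> B_norm (pnorm \<Gamma>) ?\<sigma> (\<lambda>x. h' x - h x)"
        unfolding B_norm_def by (intro cSUP_upper)
      with small show ?thesis
        by simp
    qed
    with \<delta>[OF d] show ?thesis
      using hol h h' by (simp add: calculus_diff)
  qed
  with \<open>\<delta> > 0\<close> show ?thesis
    by blast
qed

end

section \<open>Linearity, multiplicativity and continuity together\<close>

theorem theorem2p10:
  fixes p :: nat
    and smul :: "'k::{ultranormed_field, complete_space} \<Rightarrow>
                  'a::{ring_1, pnormed} \<Rightarrow> 'a"
    and A :: 'a and f g :: "'k \<Rightarrow> 'k" and \<alpha> \<beta> \<Gamma> :: 'k
    and r :: real and N :: nat and a :: "nat \<Rightarrow> 'k"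
  assumes "padic_banach_algebra p smul"
    and "algebra_analytic TYPE('x::ab_group_add) TYPE('j) smul A"
    and "calculus_well_defined p smul A"
    and "f \<in> L_space (spectrum smul A)"
    and "0 < r" and "r \<in> range (pnorm :: 'k \<Rightarrow> real)" and "pnorm \<Gamma> = r"
    and "spectrum smul A \<subseteq> (\<Union>i\<in>{1..N}. ball (a i) r)"
    and "disjoint_family_on (\<lambda>i. cball (a i) r) {1..N}"
    and "\<forall>i\<in>{1..N}. krasner_analytic f (a i) r"
    and "g \<in> L_space (spectrum smul A)"
  shows "let fA = calculus_integral p smul A f N a \<Gamma> in
    (\<lambda>x. \<alpha> * f x + \<beta> * g x) \<in> L_space (spectrum smul A) \<and>
    (\<lambda>x. f x * g x) \<in> L_space (spectrum smul A) \<and>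
    calculus p smul A (\<lambda>x. \<alpha> * f x + \<beta> * g x) = smul \<alpha> fA + smul \<beta> (calculus p smul A g) \<and>
    calculus p smul A (\<lambda>x. f x * g x) = fA * calculus p smul A g \<and>
    B_space r (spectrum smul A) \<subseteq> L_space (spectrum smul A) \<and>
    (\<forall>h\<in>B_space r (spectrum smul A). \<forall>\<epsilon>>0. \<exists>\<delta>>0. \<forall>h'\<in>B_space r (spectrum smul A).
       B_norm r (spectrum smul A) (\<lambda>x. h' x - h x) < \<delta> \<longrightarrow>
       pnorm (calculus p smul A h' - calculus p smul A h) < \<epsilon>)"
proof -
  let ?\<sigma> = "spectrum smul A"
  interpret padic_banach_algebra p smul by fact
  have "\<Gamma> \<noteq> 0"
    using assms(5,7) by auto
  \<comment> \<open>The given discs serve to identify the integral with the value of the calculus at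
    \<open>f\<close>.\<close>
  interpret F: disc_calculus p smul A N a \<Gamma>
    using assms \<open>\<Gamma> \<noteq> 0\<close> by unfold_locales auto
  have fA: "calculus_integral p smul A f N a \<Gamma> = calculus p smul A f"
    using assms(7,10) by (intro F.calculus_integral_eq) (simp add: F.hol_def)

  obtain M b s where adm: "admissible ?\<sigma> f M b s" "admissible ?\<sigma> g M b s"
    using common_admissible[OF assms(4,11)] by blast
  then obtain \<Delta> :: 'k where \<Delta>: "pnorm \<Delta> = s"
    by (auto simp: admissible_def)
  interpret C: disc_calculus p smul A M b \<Delta>
    using assms(3) adm(1) \<Delta> by unfold_locales (auto simp: admissible_def)
  have f: "C.hol f" and g: "C.hol g"
    using adm \<Delta> by (auto simp: C.hol_def admissible_def)
  have sum: "C.hol (\<lambda>x. \<alpha> * f x + \<beta> * g x)" and prod: "C.hol (\<lambda>x. f x * g x)"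
    using f g by (auto intro: C.hol_add C.hol_scale C.hol_mult)

  \<comment> \<open>Continuity is stated at radius \<open>r\<close>, so the given discs are kept
    except those that miss the spectrum.\<close>
  obtain L :: nat and c where c: "?\<sigma> \<subseteq> (\<Union>i\<in>{1..L}. ball (c i) r)"
      "disjoint_family_on (\<lambda>i. cball (c i) r) {1..L}" "\<forall>i\<in>{1..L}. ball (c i) r \<inter> ?\<sigma> \<noteq> {}"
    using relevant_discs[OF assms(8,9)] by blast
  interpret B: disc_calculus p smul A L c \<Gamma>
    using assms(3,7) c \<open>\<Gamma> \<noteq> 0\<close> by unfold_locales auto
  have "B.hol h" if "h \<in> B_space r ?\<sigma>" for h
    using that c(3) relevant_cball_subset_nbhd[of _ r ?\<sigma>] assms(5,7)
    by (auto simp: B_space_def B.hol_def)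
  then have "B_space r ?\<sigma> \<subseteq> L_space ?\<sigma>"
    using B.hol_imp_L_space by blast
  moreover note B.B_space_continuous[unfolded assms(7), OF c(3)]
  ultimately show ?thesis
    unfolding Let_def fA
    using C.hol_imp_L_space[OF sum] C.hol_imp_L_space[OF prod] C.calculus_mult[OF f g]
      C.calculus_add[OF C.hol_scale[OF f] C.hol_scale[OF g]] C.calculus_scale[OF f] C.calculus_scale[OF g]
    by simp
qed

end
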